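(* Use the parametrization $$q=e^{-\epsilon},\qquad p_{\ell+1,k}=(\ell+2-2k)\,m(\epsilon)+\epsilon^{-1}x_{\ell+1,k},\qquad z_k=e^{\imath\epsilon\lambda_k},\qquad k=1,\ldots,\ell+1,$$ where $m(\epsilon)=-[\epsilon^{-1}\ln\epsilon]$. Then the integral representation (Givental integral) of the classical $\mathfrak{gl}_{\ell+1}$-Whittaker function $\psi^{\mathfrak{gl}_{\ell+1}}$ is given by the following limit of the class one $q$-deformed $\mathfrak{gl}_{\ell+1}$-Whittaker function $\Psi^{\mathfrak{gl}_{\ell+1}}$ represented as a sum over Gelfand-Zetlin patterns: $$\psi^{\mathfrak{gl}_{\ell+1}}_{\lambda_1,\ldots,\lambda_{\ell+1}}(x_1,\ldots,x_{\ell+1})=\lim_{\epsilon\to+0}\Big[\epsilon^{\frac{\ell(\ell+1)}{2}}\,e^{\frac{\ell(\ell+3)}{2}A(\epsilon)}\,\Psi^{\mathfrak{gl}_{\ell+1}}_{z_1,\ldots,z_{\ell+1}}(\underline{p}_{\ell+1})\Big],$$ where $A(\epsilon)=-\frac{\pi^2}{6}\frac{1}{\epsilon}-\frac12\ln\frac{\epsilon}{2\pi}$ and $x_i=x_{\ell+1,i}$, $i=1,\ldots,\ell+1$.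
   Context: Notation: $\imath=\sqrt{-1}$; $[x]\in\mathbb{Z}$ is the integer part of $x$; $(n)_q!=(1-q)(1-q^2)\cdots(1-q^n)$, with $(0)_q!=1$. Empty sums are $0$ and empty products are $1$. The class one $q$-deformed Whittaker function. It is a function of $\underline{p}_{\ell+1}=(p_{\ell+1,1},\ldots,p_{\ell+1,\ell+1})$, whose entries are integers, depending on spectral variables $z_1,\ldots,z_{\ell+1}$. Let $\mathcal{P}^{(\ell+1)}(\underline{p}_{\ell+1})$ be the set of collections of integers $p_{k,i}$, $k=1,\ldots,\ell$, $i=1,\ldots,k$, satisfying the Gelfand-Zetlin conditions $p_{k+1,i}\ge p_{k,i}\ge p_{k+1,i+1}$. In the dominant domain $p_{\ell+1,1}\ge\cdots\ge p_{\ell+1,\ell+1}$, $$\Psi^{\mathfrak{gl}_{\ell+1}}_{z_1,\ldots,z_{\ell+1}}(\underline{p}_{\ell+1})=\sum_{(p_{k,i})\in\mathcal{P}^{(\ell+1)}(\underline{p}_{\ell+1})}\ \prod_{k=1}^{\ell+1}z_k^{\sum_{i=1}^{k}p_{k,i}-\sum_{i=1}^{k-1}p_{k-1,i}}\ \frac{\prod_{k=2}^{\ell}\prod_{i=1}^{k-1}(p_{k,i}-p_{k,i+1})_q!}{\prod_{k=1}^{\ell}\prod_{i=1}^{k}(p_{k+1,i}-p_{k,i})_q!\,(p_{k,i}-p_{k+1,i+1})_q!},$$ and $\Psi^{\mathfrak{gl}_{\ell+1}}_{z_1,\ldots,z_{\ell+1}}(\underline{p}_{\ell+1})=0$ outside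 the dominant domain. The classical Whittaker function (Givental integral). With $x_{\ell+1,i}=x_i$, spectral parameters $\lambda_1,\ldots,\lambda_{\ell+1}$ and integration variables $\underline{x}_k=(x_{k,1},\ldots,x_{k,k})$, $k=1,\ldots,\ell$, $$\psi^{\mathfrak{gl}_{\ell+1}}_{\lambda_1,\ldots,\lambda_{\ell+1}}(x_1,\ldots,x_{\ell+1})=\int_{C}\prod_{k=1}^{\ell}d\underline{x}_k\ e^{\mathcal{F}(x)},$$ $$\mathcal{F}(x)=\imath\sum_{n=1}^{\ell+1}\lambda_n\Big(\sum_{i=1}^{n}x_{n,i}-\sum_{i=1}^{n-1}x_{n-1,i}\Big)-\sum_{k=1}^{\ell}\sum_{i=1}^{k}\Big(e^{x_{k,i}-x_{k+1,i}}+e^{x_{k+1,i+1}-x_{k,i}}\Big),$$ where $C$ is a small deformation of the subspace $\mathbb{R}^{\ell(\ell+1)/2}\subset\mathbb{C}^{\ell(\ell+1)/2}$ making the integral convergent.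
   Formalization: Since p must be integral, x_{ℓ+1,k} in the parametrization is replaced by any X_k(ε) making p an integer vector, with X_k(ε)→x_k as ε→+0; the contour C is the undeformed real subspace, where absolute convergence is also proved. *)

theory Defs
  imports "HOL-Analysis.Analysis"
begin

(* Triangular arrays (a_{k,i}) with 1 <= i <= k <= l are encoded as functions on pairs that are
   extensional on gt_index l.  The row l+1, which is held fixed, is the argument y of with_top.
   Rows and entries are numbered from 1, as are spectral variables. *)
definition gt_index :: "nat \<Rightarrow> (nat \<times> nat) set" where
  "gt_index l = (SIGMA k:{1..l}. {1..k})"

definition with_top :: "nat \<Rightarrow> (nat \<Rightarrow> 'a) \<Rightarrow> (nat \<times> nat \<Rightarrow> 'a) \<Rightarrow> nat \<Rightarrow> nat \<Rightarrow> 'a" where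
  "with_top l y a k i = (if k = l + 1 then y i else a (k, i))"

definition qfact :: "real \<Rightarrow> nat \<Rightarrow> real" where
  "qfact q n = (\<Prod>j=1..n. 1 - q ^ j)"

definition gz_patterns :: "nat \<Rightarrow> (nat \<Rightarrow> int) \<Rightarrow> (nat \<times> nat \<Rightarrow> int) set" where
  "gz_patterns l p = {a \<in> extensional (gt_index l). \<forall>k\<in>{1..l}. \<forall>i\<in>{1..k}.
      with_top l p a (k + 1) i \<ge> with_top l p a k i \<and>
      with_top l p a k i \<ge> with_top l p a (k + 1) (i + 1)}"

(* On Gelfand-Zetlin patterns all the differences below are nonnegative, so nat does not truncate. *)
definition gz_weight :: "real \<Rightarrow> nat \<Rightarrow> (nat \<Rightarrow> nat \<Rightarrow> int) \<Rightarrow> real" where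
  "gz_weight q l P =
     (\<Prod>k=2..l. \<Prod>i=1..k-1. qfact q (nat (P k i - P k (i + 1)))) /
     (\<Prod>k=1..l. \<Prod>i=1..k. qfact q (nat (P (k + 1) i - P k i)) *
                          qfact q (nat (P k i - P (k + 1) (i + 1))))"

definition q_whittaker :: "real \<Rightarrow> nat \<Rightarrow> (nat \<Rightarrow> complex) \<Rightarrow> (nat \<Rightarrow> int) \<Rightarrow> complex" where
  "q_whittaker q l z p =
     (if \<forall>i\<in>{1..l}. p i \<ge> p (i + 1)
      then \<Sum>a\<in>gz_patterns l p. let P = with_top l p a in
             (\<Prod>k=1..l+1. z k powi ((\<Sum>i=1..k. P k i) - (\<Sum>i=1..k-1. P (k - 1) i))) *
             complex_of_real (gz_weight q l P)
      else 0)"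

definition givental_action :: "nat \<Rightarrow> (nat \<Rightarrow> complex) \<Rightarrow> (nat \<Rightarrow> nat \<Rightarrow> real) \<Rightarrow> complex" where
  "givental_action l lam X =
     \<i> * (\<Sum>n=1..l+1. lam n * complex_of_real ((\<Sum>i=1..n. X n i) - (\<Sum>i=1..n-1. X (n - 1) i))) -
     complex_of_real (\<Sum>k=1..l. \<Sum>i=1..k.
       exp (X k i - X (k + 1) i) + exp (X (k + 1) (i + 1) - X k i))"

definition givental_integrand ::
  "nat \<Rightarrow> (nat \<Rightarrow> complex) \<Rightarrow> (nat \<Rightarrow> real) \<Rightarrow> (nat \<times> nat \<Rightarrow> real) \<Rightarrow> complex" where
  "givental_integrand l lam x a = exp (givental_action l lam (with_top l x a))"

(* Lebesgue measure on the space of arrays, of dimension l(l+1)/2. *)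
definition array_lborel :: "nat \<Rightarrow> (nat \<times> nat \<Rightarrow> real) measure" where
  "array_lborel l = Pi\<^sub>M (gt_index l) (\<lambda>_. lborel)"

(* The contour is the undeformed real subspace: there the two exponentials subtracted for each
   (k,i) make the integrand decay doubly exponentially, so that the integral converges absolutely
   for all complex lam. *)
definition whittaker :: "nat \<Rightarrow> (nat \<Rightarrow> complex) \<Rightarrow> (nat \<Rightarrow> real) \<Rightarrow> complex" where
  "whittaker l lam x = integral\<^sup>L (array_lborel l) (givental_integrand l lam x)"

definition m_shift :: "real \<Rightarrow> int" where
  "m_shift \<epsilon> = - \<lfloor>ln \<epsilon> / \<epsilon>\<rfloor>"

definition A_fun :: "real \<Rightarrow> real" where
  "A_fun \<epsilon> = - (pi\<^sup>2 / 6) * (1 / \<epsilon>) - 1 / 2 * ln (\<epsilon> / (2 * pi))"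

(* The class one function lives on integer vectors, whereas (l+2-2k) m(eps) + x_k / eps is an
   integer only for special eps if x_k is a fixed nonzero real.  The parametrization is therefore
   read with x_k in the lattice eps Z: p eps is an integer vector, its coordinates
   X eps k (defined by the parametrization) may depend on eps and converge to x k.
   For every x such families exist, e.g. p eps k = (l+2-2k) m(eps) + floor (x k / eps). *)
definition whittaker_scaling ::
  "nat \<Rightarrow> (nat \<Rightarrow> real) \<Rightarrow> (real \<Rightarrow> nat \<Rightarrow> real) \<Rightarrow> (real \<Rightarrow> nat \<Rightarrow> int) \<Rightarrow> bool" where
  "whittaker_scaling l x X p \<longleftrightarrow> (\<forall>k\<in>{1..l+1}.
     (\<forall>\<epsilon>>0. real_of_int (p \<epsilon> k) =
              (real l + 2 - 2 * real k) * real_of_int (m_shift \<epsilon>) + X \<epsilon> k / \<epsilon>) \<and>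
     ((\<lambda>\<epsilon>. X \<epsilon> k) \<longlongrightarrow> x k) (at_right 0))"

end

(* With p_{k,i} = (k+1-2i) m(eps) + x_{k,i}/eps in every row, the differences in the denominator of
   the weight are m(eps) + O(1/eps) and those in the numerator 2 m(eps) + O(1/eps). Writing
   (n)_q! = (q)_oo / prod_{j>n} (1 - q^j), the tail product tends to exp(-e^{-y}) for
   n = m(eps) + y/eps and to 1 for n = 2 m(eps) + y/eps, while (q)_oo ~ e^{A(eps)} by the midpoint
   rule for sum_j ln(1 - q^j), whose error constant comes from the Wallis product. Hence the rescaled
   sum over patterns is the integral of a step function on boxes of side eps that converges pointwise
   to the Givental integrand. The tail products of the numerator are absorbed by taking square roots
   in the denominator, and prod_{j>n} (1 - q^j) <= exp(-q^{n+1}/(1-q)) then gives a doubly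
   exponential bound, so that dominated convergence applies. *)

theory Submission
  imports Defs "HOL-Real_Asymp.Real_Asymp"
begin

section \<open>Asymptotics of the Euler function\<close>

text \<open>The shift m is chosen so that exp(-eps m) is comparable to eps, hence to 1 - q: this
  puts a tail product with one copy of m exactly at the transition between 0 and 1, while two copies
  already push it to 1. The shifts (k + 1 - 2 i) m add up to zero in every row, so the spectral
  factors do not see m at all. The normalisation comes from counting. Row k contributes 2 k
  factorials below and k - 1 above, a net k + 1 Euler factors, and these numbers add up to l(l+3)/2;
  the power of eps is the volume of a box. Each Euler factor has to be known up to 1 + o(1), so the
  constant term of its logarithm matters. The midpoint errors have a summable bound free of eps and
  converge termwise to the midpoint errors of ln, whose total is Stirling's constant in disguise.
  The obstacle to domination is that tail products of the numerator enter the rescaled weight as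
  divisors and have no lower bound uniform in the pattern; they must be cancelled before anything is
  estimated.\<close>

lemma ln_one_minus_ge:
  fixes u :: real
  assumes "0 \<le> u" "u < 1"
  shows "- (u / (1 - u)) \<le> ln (1 - u)"
proof -
  have "- ln (1 - u) = ln (1 / (1 - u))"
    using assms by (simp add: ln_div)
  also have "\<dots> \<le> 1 / (1 - u) - 1"
    using assms by (intro ln_le_minus_one) simp
  also have "\<dots> = u / (1 - u)"
    using assms by (simp add: field_simps)
  finally show ?thesis by linarith
qed

text \<open>The infinite q-Pochhammer symbol (q^(n+1); q)_oo for 0 < q < 1; \<open>qtail q 0\<close>
  is the Euler function (q)_oo. Writing it as the exponential of a series makes positivity immediate
  and turns bounds into comparisons of series.\<close>

definition qtail :: "real \<Rightarrow> nat \<Rightarrow> real" where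
  "qtail q n = exp (\<Sum>j. ln (1 - q ^ (n + 1 + j)))"

context
  fixes q :: real
  assumes q: "0 < q" "q < 1"
begin

text \<open>In the lower bound the denominator 1 - q^(n+1+j) is frozen at j = 0, so that both bounds
  are geometric in j and can be summed in closed form.\<close>

lemma qtail_term_bounds:
  "- (q ^ (n + 1) / (1 - q ^ (n + 1)) * q ^ j) \<le> ln (1 - q ^ (n + 1 + j))"
  "ln (1 - q ^ (n + 1 + j)) \<le> - (q ^ (n + 1) * q ^ j)"
proof -
  have u: "0 \<le> q ^ (n + 1 + j)" "q ^ (n + 1 + j) < 1" "q ^ (n + 1) < 1"
    using q by (auto simp: power_less_one_iff simp del: power_Suc)
  have "q ^ (n + 1 + j) \<le> q ^ (n + 1)"
    using q by (intro power_decreasing) auto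
  then have "q ^ (n + 1 + j) / (1 - q ^ (n + 1 + j)) \<le> q ^ (n + 1 + j) / (1 - q ^ (n + 1))"
    using u by (intro divide_left_mono mult_pos_pos) auto
  then show "- (q ^ (n + 1) / (1 - q ^ (n + 1)) * q ^ j) \<le> ln (1 - q ^ (n + 1 + j))"
    using ln_one_minus_ge[OF u(1,2)] by (simp add: power_add)
  show "ln (1 - q ^ (n + 1 + j)) \<le> - (q ^ (n + 1) * q ^ j)"
    using ln_one_minus_pos_upper_bound[OF u(1,2)] by (simp add: power_add)
qed

lemma geometric_sums_mult: "(\<lambda>j. c * q ^ j) sums (c / (1 - q))" for c :: real
  using sums_mult[OF geometric_sums[of q], of c] q by simp

lemma summable_ln_one_minus_power: "summable (\<lambda>j. ln (1 - q ^ (n + 1 + j)))"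
proof (rule summable_comparison_test')
  show "summable (\<lambda>j. q ^ (n + 1) / (1 - q ^ (n + 1)) * q ^ j)"
    using geometric_sums_mult sums_summable by blast
  fix j
  have "0 \<le> q ^ (n + 1) * q ^ j" using q by simp
  then show "norm (ln (1 - q ^ (n + 1 + j))) \<le> q ^ (n + 1) / (1 - q ^ (n + 1)) * q ^ j"
    using qtail_term_bounds[of n j] by auto
qed

lemma qtail_pos: "0 < qtail q n"
  by (simp add: qtail_def)

lemma qtail_le: "qtail q n \<le> exp (- (q ^ (n + 1) / (1 - q)))"
proof -
  have "(\<Sum>j. ln (1 - q ^ (n + 1 + j))) \<le> (\<Sum>j. - (q ^ (n + 1)) * q ^ j)"
    using qtail_term_bounds(2)[of n] summable_ln_one_minus_power
      sums_summable[OF geometric_sums_mult[of "- (q ^ (n + 1))"]]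
    by (intro suminf_le) auto
  also have "\<dots> = - (q ^ (n + 1) / (1 - q))"
    using sums_unique[OF geometric_sums_mult[of "- (q ^ (n + 1))"]] by simp
  finally show ?thesis by (simp add: qtail_def)
qed

lemma qtail_ge: "exp (- (q ^ (n + 1) / (1 - q) / (1 - q ^ (n + 1)))) \<le> qtail q n"
proof -
  let ?c = "- (q ^ (n + 1) / (1 - q ^ (n + 1)))"
  have "?c / (1 - q) = (\<Sum>j. ?c * q ^ j)"
    using sums_unique[OF geometric_sums_mult[of ?c]] by simp
  also have "\<dots> \<le> (\<Sum>j. ln (1 - q ^ (n + 1 + j)))"
    using qtail_term_bounds(1)[of n] summable_ln_one_minus_power
      sums_summable[OF geometric_sums_mult[of ?c]]
    by (intro suminf_le) (auto simp del: power_Suc)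
  finally show ?thesis by (simp add: qtail_def mult.commute)
qed

lemma qtail_le_one: "qtail q n \<le> 1"
  by (rule order_trans[OF qtail_le]) (use q in simp)

lemma qtail_Suc: "qtail q n = (1 - q ^ (n + 1)) * qtail q (Suc n)"
proof -
  have "q ^ (n + 1) < 1" using q by (simp add: power_less_one_iff del: power_Suc)
  moreover have "(\<Sum>j. ln (1 - q ^ (n + 1 + j))) =
      (\<Sum>j. ln (1 - q ^ (Suc n + 1 + j))) + ln (1 - q ^ (n + 1))"
    using suminf_split_head[OF summable_ln_one_minus_power[of n]] by simp
  ultimately show ?thesis by (simp add: qtail_def exp_add)
qed

lemma qfact_mult_qtail: "qfact q n * qtail q n = qtail q 0"
proof (induction n)
  case 0
  then show ?case by (simp add: qfact_def)
next
  case (Suc n)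
  have "qfact q (Suc n) * qtail q (Suc n) = qfact q n * qtail q n"
    by (subst qtail_Suc[of n]) (simp add: qfact_def)
  then show ?case using Suc by simp
qed

lemma qfact_eq: "qfact q n = qtail q 0 / qtail q n"
  using qfact_mult_qtail[of n] qtail_pos[of n] by (simp add: field_simps)

lemma qtail_mono:
  assumes "m \<le> n"
  shows "qtail q m \<le> qtail q n"
  using assms
proof (induction rule: dec_induct)
  case (step n)
  have "qtail q n \<le> qtail q (Suc n)"
    using q qtail_pos[of "Suc n"] by (subst qtail_Suc) (auto intro!: mult_left_le_one_le simp: power_le_one)
  with step show ?case by simp
qed simp

text \<open>Tail products increase with n, so the geometric mean g of \<open>qtail q m\<close> and
  \<open>qtail q n\<close> is at most \<open>qtail q (m + n)\<close>. Hence the product g^2 is at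
  most g times \<open>qtail q (m + n)\<close>.\<close>

lemma qtail_mult_le:
  "qtail q m * qtail q n / qtail q (m + n) \<le> sqrt (qtail q m) * sqrt (qtail q n)"
proof -
  have le: "qtail q m \<le> qtail q (m + n)" "qtail q n \<le> qtail q (m + n)"
    by (auto intro: qtail_mono)
  have "sqrt (qtail q m) * sqrt (qtail q n) \<le> sqrt (qtail q (m + n)) * sqrt (qtail q (m + n))"
    using le by (intro mult_mono) (auto simp: qtail_pos less_imp_le)
  then have *: "sqrt (qtail q m) * sqrt (qtail q n) \<le> qtail q (m + n)"
    by (simp add: qtail_pos less_imp_le)
  have "qtail q m * qtail q n = (sqrt (qtail q m) * sqrt (qtail q n)) * (sqrt (qtail q m) * sqrt (qtail q n))"
    by (simp add: qtail_pos less_imp_le mult_ac flip: real_sqrt_mult)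
  also have "\<dots> \<le> (sqrt (qtail q m) * sqrt (qtail q n)) * qtail q (m + n)"
    using * by (intro mult_left_mono) (auto simp: qtail_pos less_imp_le)
  finally show ?thesis by (simp add: qtail_pos divide_le_eq)
qed

end

text \<open>Convergence of q^(n+1) / (1 - q) forces q^(n+1) to 0 because 1 - q vanishes. The
  exponents of the upper and lower bounds differ by the factor 1 / (1 - q^(n+1)), so they have the
  same limit.\<close>

lemma tendsto_qtail:
  fixes n :: "real \<Rightarrow> nat"
  assumes "((\<lambda>\<epsilon>. exp (- \<epsilon>) ^ (n \<epsilon> + 1) / (1 - exp (- \<epsilon>))) \<longlongrightarrow> w) (at_right 0)"
  shows "((\<lambda>\<epsilon>. qtail (exp (- \<epsilon>)) (n \<epsilon>)) \<longlongrightarrow> exp (- w)) (at_right 0)"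
proof -
  have "((\<lambda>\<epsilon>::real. 1 - exp (- \<epsilon>)) \<longlongrightarrow> 0) (at_right 0)"
    by real_asymp
  from tendsto_mult[OF assms this]
  have "((\<lambda>\<epsilon>. exp (- \<epsilon>) ^ (n \<epsilon> + 1) / (1 - exp (- \<epsilon>)) * (1 - exp (- \<epsilon>))) \<longlongrightarrow> 0) (at_right 0)"
    by simp
  then have u: "((\<lambda>\<epsilon>. exp (- \<epsilon>) ^ (n \<epsilon> + 1)) \<longlongrightarrow> 0) (at_right 0)"
    by (rule Lim_transform_eventually)
       (auto intro!: eventually_mono[OF eventually_at_right_less[of "0::real"]] simp del: power_Suc)
  have "((\<lambda>\<epsilon>. exp (- (exp (- \<epsilon>) ^ (n \<epsilon> + 1) / (1 - exp (- \<epsilon>)) / (1 - exp (- \<epsilon>) ^ (n \<epsilon> + 1)))))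
      \<longlongrightarrow> exp (- (w / (1 - 0)))) (at_right 0)"
    by (intro tendsto_intros assms u) simp
  moreover have "((\<lambda>\<epsilon>. exp (- (exp (- \<epsilon>) ^ (n \<epsilon> + 1) / (1 - exp (- \<epsilon>))))) \<longlongrightarrow> exp (- w)) (at_right 0)"
    by (intro tendsto_intros assms)
  moreover have "eventually (\<lambda>\<epsilon>. exp (- (exp (- \<epsilon>) ^ (n \<epsilon> + 1) / (1 - exp (- \<epsilon>)) / (1 - exp (- \<epsilon>) ^ (n \<epsilon> + 1))))
      \<le> qtail (exp (- \<epsilon>)) (n \<epsilon>)) (at_right 0)"
    by (rule eventually_mono[OF eventually_at_right_less[of "0::real"]]) (rule qtail_ge; simp)
  moreover have "eventually (\<lambda>\<epsilon>. qtail (exp (- \<epsilon>)) (n \<epsilon>) \<le>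
      exp (- (exp (- \<epsilon>) ^ (n \<epsilon> + 1) / (1 - exp (- \<epsilon>))))) (at_right 0)"
    by (rule eventually_mono[OF eventually_at_right_less[of "0::real"]]) (rule qtail_le; simp)
  ultimately show ?thesis
    using tendsto_sandwich by fastforce
qed

section \<open>The dilogarithm of exp(-t) and its expansion at 0\<close>

text \<open>This is the dilogarithm of \<open>exp (- t)\<close>. As an antiderivative of \<open>ln (1 - exp (- t))\<close> it
  replaces the integrals of the midpoint rule by telescoping differences.\<close>

definition dilog_exp :: "real \<Rightarrow> real" where
  "dilog_exp t = (\<Sum>n. exp (- t) ^ Suc n / (real (Suc n))\<^sup>2)"

lemma summable_inverse_squares_Suc: "summable (\<lambda>n. 1 / (real (Suc n))\<^sup>2)"
  using sums_summable[OF inverse_squares_sums] by (simp add: add.commute)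

lemma dilog_exp_0: "dilog_exp 0 = pi\<^sup>2 / 6"
  using sums_unique[OF inverse_squares_sums] by (simp add: dilog_exp_def add.commute)

lemma continuous_on_dilog_exp: "continuous_on {0..} dilog_exp"
  unfolding dilog_exp_def[abs_def]
proof (rule uniform_limit_theorem)
  show "uniform_limit {0..} (\<lambda>N t. \<Sum>n<N. exp (- t) ^ Suc n / (real (Suc n))\<^sup>2)
      (\<lambda>t. \<Sum>n. exp (- t) ^ Suc n / (real (Suc n))\<^sup>2) sequentially"
  proof (rule Weierstrass_m_test)
    show "summable (\<lambda>n. 1 / (real (Suc n))\<^sup>2)" by (rule summable_inverse_squares_Suc)
    fix n :: nat and t :: real assume "t \<in> {0..}"
    then have "exp (- t) ^ Suc n \<le> 1" by (intro power_le_one) auto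
    then show "norm (exp (- t) ^ Suc n / (real (Suc n))\<^sup>2) \<le> 1 / (real (Suc n))\<^sup>2"
      by (simp add: divide_right_mono del: power_Suc of_nat_Suc)
  qed
qed (auto intro!: always_eventually continuous_intros)

lemma ln_one_minus_sums:
  fixes x :: real
  assumes "0 < x" "x < 1"
  shows "(\<lambda>n. - (x ^ Suc n / real (Suc n))) sums ln (1 - x)"
proof -
  have "(\<lambda>n. - ((-(-x))^n) / of_nat n) sums ln (1 + (-x))"
    using assms by (intro ln_series') auto
  then have "(\<lambda>n. - (x ^ n) / real n) sums ln (1 - x)" by simp
  \<comment> \<open>The term n = 0 is a division by zero, hence 0, and shifting the index leaves the
    sum unchanged.\<close>
  then show ?thesis
    by (subst sums_Suc_iff) simp
qed

text \<open>Termwise differentiation in x = exp(-t) gives -ln(1 - x) / x, and the chain rule factor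
  -x removes the denominator.\<close>

lemma DERIV_dilog_exp:
  assumes "0 < t"
  shows "(dilog_exp has_real_derivative ln (1 - exp (- t))) (at t)"
proof -
  let ?x = "exp (- t)"
  have x: "0 < ?x" "?x < 1" using assms by auto
  have "- 1 < ?x" using x(1) by linarith
  have "((\<lambda>x. \<Sum>n. (1 / (real (Suc n))\<^sup>2) * x ^ Suc n) has_real_derivative
      (\<Sum>n. (1 / (real (Suc n))\<^sup>2) * real (Suc n) * ?x ^ n)) (at ?x)"
  proof (rule DERIV_power_series')
    fix y :: real assume "y \<in> {-1<..<1}"
    then have y: "\<bar>y\<bar> < 1" by auto
    show "summable (\<lambda>n. 1 / (real (Suc n))\<^sup>2 * real (Suc n) * y ^ n)"
    proof (rule summable_comparison_test')
      show "summable (\<lambda>n. \<bar>y\<bar> ^ n)" using y by (simp add: summable_geometric)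
      fix n
      have "1 / (real (Suc n))\<^sup>2 * real (Suc n) \<le> 1"
        by (simp add: power2_eq_square del: of_nat_Suc)
      moreover have "0 \<le> \<bar>y\<bar> ^ n" by simp
      ultimately have "(1 / (real (Suc n))\<^sup>2 * real (Suc n)) * \<bar>y\<bar> ^ n \<le> 1 * \<bar>y\<bar> ^ n"
        by (intro mult_right_mono)
      then show "norm (1 / (real (Suc n))\<^sup>2 * real (Suc n) * y ^ n) \<le> \<bar>y\<bar> ^ n"
        by (simp add: abs_mult power_abs)
    qed
  qed (use assms \<open>- 1 < ?x\<close> in auto)
  then have P: "((\<lambda>x. \<Sum>n. x ^ Suc n / (real (Suc n))\<^sup>2) has_real_derivative
      (\<Sum>n. ?x ^ n / real (Suc n))) (at ?x)"
    by (simp add: power2_eq_square del: power_Suc of_nat_Suc)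
  have E: "((\<lambda>t. exp (- t)) has_real_derivative - ?x) (at t)"
    by (auto intro!: derivative_eq_intros)
  have D: "(dilog_exp has_real_derivative (\<Sum>n. ?x ^ n / real (Suc n)) * (- ?x)) (at t)"
    using DERIV_chain2[OF P E] by (simp add: dilog_exp_def[abs_def])
  have "(\<lambda>n. - (?x ^ Suc n / real (Suc n)) * (- 1 / ?x)) sums (ln (1 - ?x) * (- 1 / ?x))"
    by (intro sums_mult2 ln_one_minus_sums x)
  then have "(\<lambda>n. ?x ^ n / real (Suc n)) sums (ln (1 - ?x) * (- 1 / ?x))"
    by simp
  then have "(\<Sum>n. ?x ^ n / real (Suc n)) = ln (1 - ?x) * (- 1 / ?x)"
    by (rule sums_unique[symmetric])
  with D show ?thesis by simp
qed

lemma tendsto_dilog_exp_at_top: "(dilog_exp \<longlongrightarrow> 0) at_top"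
proof (rule tendsto_sandwich)
  have sq: "(\<lambda>n. exp (- t) * (1 / (real (Suc n))\<^sup>2)) sums (exp (- t) * (pi\<^sup>2 / 6))" for t :: real
    using sums_mult[OF inverse_squares_sums, of "exp (- t)"] by (simp add: add.commute)
  have le: "exp (- t) ^ Suc n / (real (Suc n))\<^sup>2 \<le> exp (- t) * (1 / (real (Suc n))\<^sup>2)"
    if "0 \<le> t" for t :: real and n
  proof -
    have "exp (- t) * exp (- t) ^ n \<le> exp (- t) * 1"
      using that by (intro mult_left_mono power_le_one) auto
    then show ?thesis by (simp add: divide_right_mono del: of_nat_Suc)
  qed
  have sm: "summable (\<lambda>n. exp (- t) ^ Suc n / (real (Suc n))\<^sup>2)" if "0 \<le> t" for t :: real
    by (rule summable_comparison_test'[OF sums_summable[OF sq[of t]]])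
       (use le[OF that] in \<open>simp del: of_nat_Suc power_Suc\<close>)
  show "eventually (\<lambda>t. 0 \<le> dilog_exp t) at_top"
    using eventually_ge_at_top[of 0]
    by eventually_elim (auto simp: dilog_exp_def intro!: suminf_nonneg sm simp del: of_nat_Suc power_Suc)
  show "eventually (\<lambda>t. dilog_exp t \<le> exp (- t) * (pi\<^sup>2 / 6)) at_top"
    using eventually_ge_at_top[of 0]
  proof eventually_elim
    case (elim t)
    then have "dilog_exp t \<le> (\<Sum>n. exp (- t) * (1 / (real (Suc n))\<^sup>2))"
      unfolding dilog_exp_def by (intro suminf_le le sm sums_summable[OF sq])
    also have "\<dots> = exp (- t) * (pi\<^sup>2 / 6)" using sums_unique[OF sq] by simp
    finally show ?case .
  qed
  show "((\<lambda>t::real. exp (- t) * (pi\<^sup>2 / 6)) \<longlongrightarrow> 0) at_top"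
    by real_asymp
qed auto

text \<open>The remainder, divided by t, of the expansion pi^2/6 + t ln t - t of the dilogarithm as
  t tends to 0.\<close>

definition dilog_exp_error :: "real \<Rightarrow> real" where
  "dilog_exp_error t = (dilog_exp t - pi\<^sup>2 / 6 - t * ln t + t) / t"

text \<open>By L'Hopital, since the numerator has derivative ln((1 - exp(-t)) / t). That the
  numerator itself vanishes at 0 needs continuity of \<open>dilog_exp\<close> up to the endpoint,
  where the derivative blows up.\<close>

lemma tendsto_dilog_exp_error: "(dilog_exp_error \<longlongrightarrow> 0) (at_right 0)"
  unfolding dilog_exp_error_def[abs_def]
proof (rule lhopital_right_0)
  have "(dilog_exp \<longlongrightarrow> dilog_exp 0) (at_right 0)"
    using continuous_on_dilog_exp unfolding continuous_on_def
    by (auto intro: tendsto_within_subset)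
  then have "((\<lambda>t. dilog_exp t - pi\<^sup>2 / 6) \<longlongrightarrow> 0) (at_right 0)"
    by (auto simp: dilog_exp_0 intro!: tendsto_eq_intros)
  moreover have "((\<lambda>t::real. t - t * ln t) \<longlongrightarrow> 0) (at_right 0)"
    by real_asymp
  ultimately have "((\<lambda>t. (dilog_exp t - pi\<^sup>2 / 6) + (t - t * ln t)) \<longlongrightarrow> 0 + 0) (at_right 0)"
    by (intro tendsto_add)
  then show "((\<lambda>t. dilog_exp t - pi\<^sup>2 / 6 - t * ln t + t) \<longlongrightarrow> 0) (at_right 0)"
    by (simp add: algebra_simps)
  show "eventually (\<lambda>t. ((\<lambda>t. dilog_exp t - pi\<^sup>2 / 6 - t * ln t + t) has_real_derivative
      (ln (1 - exp (- t)) - ln t)) (at t)) (at_right 0)"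
    using eventually_at_right_less[of "0::real"]
    by eventually_elim (auto intro!: derivative_eq_intros DERIV_dilog_exp)
  show "((\<lambda>t::real. (ln (1 - exp (- t)) - ln t) / 1) \<longlongrightarrow> 0) (at_right 0)"
    by real_asymp
  show "((\<lambda>t::real. t) \<longlongrightarrow> 0) (at_right 0)"
    by real_asymp
  show "eventually (\<lambda>t::real. t \<noteq> 0) (at_right 0)"
    using eventually_at_right_less[of "0::real"] by eventually_elim auto
qed (auto intro!: always_eventually derivative_eq_intros)

lemma dilog_exp_eq:
  assumes "0 < t"
  shows "dilog_exp t = pi\<^sup>2 / 6 + t * ln t - t + t * dilog_exp_error t"
  using assms by (simp add: dilog_exp_error_def)

section \<open>Midpoint rule for ln(1 - exp(-t))\<close>

text \<open>Bounds the third derivative of \<open>dilog_exp\<close>. The fraction splits into 1/(e^t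
  - 1) + 1/(e^t - 1)^2; the first summand uses e^t - 1 >= t^2/2, the second e^t - 1 >= t, which
  gives 2 + 1 = 3.\<close>

lemma exp_div_exp_minus_one_squared_le:
  fixes t :: real
  assumes "0 < t"
  shows "exp t / (exp t - 1)\<^sup>2 \<le> 3 / t\<^sup>2"
proof -
  have g: "exp t \<ge> 1 + t + t\<^sup>2 / 2"
    using assms by (intro exp_lower_Taylor_quadratic) auto
  have le: "t \<le> exp t - 1" using exp_ge_add_one_self[of t] by linarith
  have "(u + 1) / u\<^sup>2 = 1 / u + 1 / u\<^sup>2" for u :: real
    by (simp add: add_divide_distrib power2_eq_square)
  from this[of "exp t - 1"] have "exp t / (exp t - 1)\<^sup>2 = 1 / (exp t - 1) + 1 / (exp t - 1)\<^sup>2"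
    by simp
  also have "1 / (exp t - 1) \<le> 1 / (t\<^sup>2 / 2)"
    using g assms by (intro divide_left_mono mult_pos_pos) auto
  also have "1 / (exp t - 1)\<^sup>2 \<le> 1 / t\<^sup>2"
    using assms by (intro divide_left_mono power_mono le mult_pos_pos zero_less_power) auto
  finally show ?thesis by simp
qed

text \<open>In the difference of the Taylor expansions from c to both sides the even orders cancel.
  What remains beyond the midpoint term is the third-order remainder at two intermediate points,
  both to the right of c - r.\<close>

lemma dilog_exp_midpoint:
  assumes "0 < r" "r < c"
  shows "\<bar>dilog_exp (c + r) - dilog_exp (c - r) - 2 * r * ln (1 - exp (- c))\<bar> \<le> r ^ 3 / (c - r)\<^sup>2"
proof -
  define d where "d m = (if m = 0 then dilog_exp else if m = 1 then (\<lambda>t. ln (1 - exp (- t)))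
      else if m = 2 then (\<lambda>t. 1 / (exp t - 1)) else (\<lambda>t. - (exp t / (exp t - 1)\<^sup>2)))" for m :: nat
  have D: "\<forall>m t. m < 3 \<and> c - r \<le> t \<and> t \<le> c + r \<longrightarrow> DERIV (d m) t :> d (Suc m) t"
  proof (intro allI impI)
    fix m :: nat and t :: real assume *: "m < 3 \<and> c - r \<le> t \<and> t \<le> c + r"
    then have t: "0 < t" using assms by auto
    have "m = 0 \<or> m = 1 \<or> m = 2" using * by auto
    then show "DERIV (d m) t :> d (Suc m) t"
    proof (elim disjE)
      assume "m = 0"
      then show ?thesis using DERIV_dilog_exp[OF t] by (simp add: d_def)
    next
      assume "m = 1"
      then show ?thesis using t
        by (auto simp: d_def exp_minus field_simps intro!: derivative_eq_intros)
    next
      assume "m = 2"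
      then show ?thesis using t
        by (auto simp: d_def power2_eq_square intro!: derivative_eq_intros)
    qed
  qed
  obtain t1 where t1: "c < t1" "t1 < c + r" "dilog_exp (c + r) =
      (\<Sum>m<3. (d m c / fact m) * ((c + r) - c) ^ m) + (d 3 t1 / fact 3) * ((c + r) - c) ^ 3"
    using Taylor_up[of 3 d dilog_exp "c - r" "c + r" c] D assms by (auto simp: d_def)
  obtain t2 where t2: "c - r < t2" "t2 < c" "dilog_exp (c - r) =
      (\<Sum>m<3. (d m c / fact m) * ((c - r) - c) ^ m) + (d 3 t2 / fact 3) * ((c - r) - c) ^ 3"
    using Taylor_down[of 3 d dilog_exp "c - r" "c + r" c] D assms by (auto simp: d_def)
  have eq: "dilog_exp (c + r) - dilog_exp (c - r) - 2 * r * ln (1 - exp (- c)) =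
      (d 3 t1 + d 3 t2) * r ^ 3 / 6"
  proof -
    have d: "d 0 c = dilog_exp c" "d (Suc 0) c = ln (1 - exp (- c))"
      by (simp_all add: d_def)
    have "{..<3} = {0, Suc 0, 2}" by auto
    then show ?thesis
      unfolding t1(3) t2(3) by (simp add: d fact_numeral power3_eq_cube field_simps)
  qed
  have b: "\<bar>d 3 t\<bar> \<le> 3 / (c - r)\<^sup>2" if "c - r < t" for t
  proof -
    have "\<bar>d 3 t\<bar> \<le> 3 / t\<^sup>2"
      using exp_div_exp_minus_one_squared_le[of t] that assms by (simp add: d_def)
    also have "\<dots> \<le> 3 / (c - r)\<^sup>2"
      using that assms by (intro divide_left_mono power_mono mult_pos_pos) auto
    finally show ?thesis .
  qed
  have "\<bar>d 3 t1 + d 3 t2\<bar> \<le> 6 / (c - r)\<^sup>2"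
    using b[of t1] b[of t2] t1 t2 assms by linarith
  then have "\<bar>d 3 t1 + d 3 t2\<bar> * r ^ 3 \<le> 6 / (c - r)\<^sup>2 * r ^ 3"
    using assms by (intro mult_right_mono) auto
  then show ?thesis unfolding eq using assms by (simp add: abs_mult mult_ac)
qed

section \<open>The error constant from the Wallis product\<close>

text \<open>The numerators multiply to (2^n n!)^2; the denominators (2k - 1)(2k + 1) give squares of
  odd numbers, that is ((2n)! / (2^n n!))^2 (2n + 1). In this form the product can be compared with
  logarithms of factorials.\<close>

lemma wallis_prod_eq:
  "(\<Prod>k=1..n. (4 * real k ^ 2) / (4 * real k ^ 2 - 1)) = (2 ^ n * fact n) ^ 4 / ((fact (2 * n))\<^sup>2 * (2 * real n + 1))"
proof (induction n)
  case (Suc n)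
  have alg: "a ^ 4 / (G\<^sup>2 * d) * (4 * c\<^sup>2 / (d * e)) = (2 * c * a) ^ 4 / ((2 * c * d * G)\<^sup>2 * e)"
    if "c \<noteq> 0" "d \<noteq> 0" "e \<noteq> 0" "G \<noteq> 0" for a c d e G :: real
    using that by (simp add: divide_simps) algebra
  have "4 * real (Suc n) ^ 2 - 1 = (2 * real n + 1) * (2 * real (Suc n) + 1)"
    by (simp add: power2_eq_square algebra_simps)
  moreover have "fact (2 * Suc n) = 2 * real (Suc n) * (2 * real n + 1) * fact (2 * n)"
    by (simp add: algebra_simps)
  moreover have "2 ^ Suc n * fact (Suc n) = 2 * real (Suc n) * (2 ^ n * fact n)"
    by simp
  ultimately show ?case
    using alg[of "real (Suc n)" "2 * real n + 1" "2 * real (Suc n) + 1" "fact (2 * n)" "2 ^ n * fact n"]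
    by (simp only: prod.nat_ivl_Suc' Suc le_add1 plus_1_eq_Suc) (simp add: mult.commute)
qed simp

text \<open>The midpoint error for the integral of ln over [k + 1/2, k + 3/2], evaluated with the
  antiderivative x ln x - x.\<close>

definition ln_midpoint_error :: "nat \<Rightarrow> real" where
  "ln_midpoint_error k = ln (real (Suc k)) -
     ((real (Suc k) + 1/2) * ln (real (Suc k) + 1/2) - (real k + 1/2) * ln (real k + 1/2) - 1)"

lemma sum_ln_midpoint_error:
  "(\<Sum>k<n. ln_midpoint_error k) =
     ln (fact n) - (real n + 1/2) * ln (real n + 1/2) + real n + 1/2 * ln (1/2)"
proof (induction n)
  case (Suc n)
  have "ln (fact (Suc n) :: real) = ln (real (Suc n)) + ln (fact n)"
    by (simp add: ln_mult del: of_nat_Suc)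
  with Suc show ?case by (simp add: ln_midpoint_error_def)
qed simp

text \<open>The combination 2 S(n) - S(2n) of partial sums has the same limit as S(n), and
  factorials enter it as 2 ln n! - ln (2n)!, which is half the logarithm of the Wallis product up to
  elementary terms. Summability is a hypothesis here because it comes for free when Tannery's
  theorem is applied to the Euler function.\<close>

lemma ln_midpoint_error_sums:
  assumes "summable ln_midpoint_error"
  shows "suminf ln_midpoint_error = ln pi / 2 - 1 / 2"
proof -
  define S where "S n = (\<Sum>k<n. ln_midpoint_error k)" for n
  define W where "W n = (\<Prod>k=1..n. (4 * real k ^ 2) / (4 * real k ^ 2 - 1))" for n
  have S: "S \<longlonglongrightarrow> suminf ln_midpoint_error"
    using summable_LIMSEQ[OF assms] by (simp add: S_def[abs_def])
  moreover have "(\<lambda>n. S (n * 2)) \<longlonglongrightarrow> suminf ln_midpoint_error"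
    using S by (rule filterlim_compose) real_asymp
  ultimately have "(\<lambda>n. 2 * S n - S (n * 2)) \<longlonglongrightarrow> 2 * suminf ln_midpoint_error - suminf ln_midpoint_error"
    by (intro tendsto_intros)
  moreover have "(\<lambda>n. 2 * S n - S (n * 2)) \<longlonglongrightarrow> ln (pi / 2) / 2 + (ln 2 / 2 - 1 / 2)"
  proof (rule Lim_transform_eventually)
    have "W \<longlonglongrightarrow> pi / 2" using wallis by (simp add: W_def[abs_def])
    then have "(\<lambda>n. ln (W n) / 2) \<longlonglongrightarrow> ln (pi / 2) / 2"
      by (intro tendsto_intros) auto
    moreover have "(\<lambda>n. ln (2 * real n + 1) / 2 - 2 * real n * ln 2 - 2 * (real n + 1/2) * ln (real n + 1/2)
        + (2 * real n + 1/2) * ln (2 * real n + 1/2) + 1/2 * ln (1/2)) \<longlonglongrightarrow> ln 2 / 2 - 1 / 2"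
      by (real_asymp simp: ln_div)
    ultimately show "(\<lambda>n. ln (W n) / 2 + (ln (2 * real n + 1) / 2 - 2 * real n * ln 2 - 2 * (real n + 1/2) * ln (real n + 1/2)
        + (2 * real n + 1/2) * ln (2 * real n + 1/2) + 1/2 * ln (1/2))) \<longlonglongrightarrow> ln (pi / 2) / 2 + (ln 2 / 2 - 1 / 2)"
      by (rule tendsto_add)
    have lnW: "ln (W n) = 4 * (real n * ln 2 + ln (fact n)) - 2 * ln (fact (2 * n)) - ln (2 * real n + 1)" for n
      unfolding W_def wallis_prod_eq
      by (simp add: ln_div ln_mult ln_realpow add_pos_nonneg)
    show "eventually (\<lambda>n. ln (W n) / 2 + (ln (2 * real n + 1) / 2 - 2 * real n * ln 2 - 2 * (real n + 1/2) * ln (real n + 1/2)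
        + (2 * real n + 1/2) * ln (2 * real n + 1/2) + 1/2 * ln (1/2)) = 2 * S n - S (n * 2)) sequentially"
      by (intro always_eventually allI) (simp only: S_def sum_ln_midpoint_error lnW, simp add: field_simps)
  qed
  ultimately have "2 * suminf ln_midpoint_error - suminf ln_midpoint_error = ln (pi / 2) / 2 + (ln 2 / 2 - 1 / 2)"
    by (rule LIMSEQ_unique)
  then show ?thesis by (simp add: ln_div field_simps)
qed

section \<open>The Euler function as q tends to 1\<close>

text \<open>The k-th midpoint error for ln(1 - exp(-t)) on [eps (k + 1/2), eps (k + 3/2)], divided
  by eps. The midpoint eps (k + 1) yields the factor 1 - q^(k+1).\<close>

definition euler_midpoint_error :: "nat \<Rightarrow> real \<Rightarrow> real" where
  "euler_midpoint_error k \<epsilon> = ln (1 - exp (- \<epsilon>) ^ Suc k) -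
     (dilog_exp (\<epsilon> * (real (Suc k) + 1/2)) - dilog_exp (\<epsilon> * (real k + 1/2))) / \<epsilon>"

text \<open>With half-width r = eps/2 and centre c = eps (k + 1), the bound r^3 / (c - r)^2 is
  linear in eps, so dividing by eps removes eps altogether. This uniformity is what Tannery's
  theorem needs.\<close>

lemma abs_euler_midpoint_error_le:
  assumes "0 < \<epsilon>"
  shows "\<bar>euler_midpoint_error k \<epsilon>\<bar> \<le> 1 / (real (Suc k))\<^sup>2"
proof -
  let ?j = "real (Suc k)"
  let ?D = "dilog_exp (\<epsilon> * (?j + 1/2)) - dilog_exp (\<epsilon> * (real k + 1/2)) - \<epsilon> * ln (1 - exp (- (\<epsilon> * ?j)))"
  have e: "\<epsilon> * ?j - \<epsilon> / 2 = \<epsilon> * (real k + 1/2)" "\<epsilon> * ?j + \<epsilon> / 2 = \<epsilon> * (?j + 1/2)"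
    by (simp_all add: algebra_simps)
  have "0 < \<epsilon> / 2" "\<epsilon> / 2 < \<epsilon> * ?j"
    using assms by (auto simp: field_simps add_pos_nonneg)
  from dilog_exp_midpoint[OF this, unfolded e]
  have "\<bar>?D\<bar> \<le> (\<epsilon> / 2) ^ 3 / (\<epsilon> * (real k + 1/2))\<^sup>2"
    by (simp del: of_nat_Suc)
  also have "\<dots> = \<epsilon> / (8 * (real k + 1/2)\<^sup>2)"
    using assms by (simp add: power_mult_distrib power_divide eval_nat_numeral)
  also have "\<dots> \<le> \<epsilon> / ?j\<^sup>2"
  proof (intro divide_left_mono mult_pos_pos)
    have "?j\<^sup>2 \<le> (2 * (real k + 1/2))\<^sup>2" by (intro power_mono) auto
    also have "\<dots> = 4 * (real k + 1/2)\<^sup>2" by (simp only: power_mult_distrib) simp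
    also have "\<dots> \<le> 8 * (real k + 1/2)\<^sup>2" by simp
    finally show "?j\<^sup>2 \<le> 8 * (real k + 1/2)\<^sup>2" .
  qed (use assms in auto)
  finally have "\<bar>?D\<bar> / \<epsilon> \<le> 1 / ?j\<^sup>2"
    using assms by (simp add: divide_le_eq mult.commute)
  moreover have "exp (- (\<epsilon> * ?j)) = exp (- \<epsilon>) ^ Suc k"
    by (simp add: exp_of_nat_mult[symmetric] mult.commute del: of_nat_Suc power_Suc)
  then have "euler_midpoint_error k \<epsilon> = - (?D / \<epsilon>)"
    using assms by (simp add: euler_midpoint_error_def diff_divide_distrib del: of_nat_Suc power_Suc)
  ultimately show ?thesis using assms by (simp add: abs_divide del: of_nat_Suc power_Suc)
qed

text \<open>After inserting the expansion of the dilogarithm at both endpoints, the terms pi^2/(6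
  eps) cancel, and so does ln eps, because the endpoints differ by eps times 1.\<close>

lemma tendsto_euler_midpoint_error:
  "((\<lambda>\<epsilon>. euler_midpoint_error k \<epsilon>) \<longlongrightarrow> ln_midpoint_error k) (at_right 0)"
proof (rule Lim_transform_eventually)
  let ?j = "real (Suc k)"
  have E: "((\<lambda>\<epsilon>. s * dilog_exp_error (\<epsilon> * s)) \<longlongrightarrow> 0) (at_right 0)" if "0 < s" for s :: real
  proof -
    have "filterlim (\<lambda>\<epsilon>::real. \<epsilon> * s) (at_right 0) (at_right 0)"
      using that by real_asymp
    from filterlim_compose[OF tendsto_dilog_exp_error this] show ?thesis
      by (auto intro!: tendsto_eq_intros)
  qed
  have "((\<lambda>\<epsilon>. ln (1 - exp (- (\<epsilon> * j))) - ln \<epsilon>) \<longlongrightarrow> ln j) (at_right 0)" if "0 < j" for j :: real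
    using that by real_asymp
  from this[of ?j] have "((\<lambda>\<epsilon>. (ln (1 - exp (- (\<epsilon> * ?j))) - ln \<epsilon>)
      - ((?j + 1/2) * ln (?j + 1/2) - (real k + 1/2) * ln (real k + 1/2) - 1)
      - ((?j + 1/2) * dilog_exp_error (\<epsilon> * (?j + 1/2)) - (real k + 1/2) * dilog_exp_error (\<epsilon> * (real k + 1/2))))
      \<longlongrightarrow> ln ?j - ((?j + 1/2) * ln (?j + 1/2) - (real k + 1/2) * ln (real k + 1/2) - 1) - (0 - 0)) (at_right 0)"
    by (intro tendsto_diff tendsto_const E) auto
  then show "((\<lambda>\<epsilon>. (ln (1 - exp (- (\<epsilon> * ?j))) - ln \<epsilon>)
      - ((?j + 1/2) * ln (?j + 1/2) - (real k + 1/2) * ln (real k + 1/2) - 1)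
      - ((?j + 1/2) * dilog_exp_error (\<epsilon> * (?j + 1/2)) - (real k + 1/2) * dilog_exp_error (\<epsilon> * (real k + 1/2))))
      \<longlongrightarrow> ln_midpoint_error k) (at_right 0)"
    by (simp add: ln_midpoint_error_def)
  show "eventually (\<lambda>\<epsilon>. (ln (1 - exp (- (\<epsilon> * ?j))) - ln \<epsilon>)
      - ((?j + 1/2) * ln (?j + 1/2) - (real k + 1/2) * ln (real k + 1/2) - 1)
      - ((?j + 1/2) * dilog_exp_error (\<epsilon> * (?j + 1/2)) - (real k + 1/2) * dilog_exp_error (\<epsilon> * (real k + 1/2)))
      = euler_midpoint_error k \<epsilon>) (at_right 0)"
    using eventually_at_right_less[of "0::real"]
  proof eventually_elim
    case (elim \<epsilon>)
    have H: "dilog_exp (\<epsilon> * s) / \<epsilon> = pi\<^sup>2 / 6 / \<epsilon> + s * ln \<epsilon> + s * ln s - s + s * dilog_exp_error (\<epsilon> * s)"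
      if "0 < s" for s :: real
      using that elim by (subst dilog_exp_eq) (simp_all add: ln_mult field_simps)
    have x: "exp (- (\<epsilon> * ?j)) = exp (- \<epsilon>) ^ Suc k"
      by (simp add: exp_of_nat_mult[symmetric] mult.commute del: of_nat_Suc power_Suc)
    show ?case
      unfolding euler_midpoint_error_def x diff_divide_distrib
      by (subst (1 2) H) (auto simp: algebra_simps)
  qed
qed

text \<open>ln (q)_oo is the sum of the midpoint errors minus dilog_exp(eps/2)/eps, the contribution
  of the left end. The expansion of the latter contributes pi^2/(6 eps) + ln(eps/2)/2 - 1/2, and the
  error sum tends to ln(pi)/2 - 1/2; together they are \<open>A_fun\<close> up to o(1).\<close>

lemma tendsto_exp_A_fun_div_qtail_0:
  "((\<lambda>\<epsilon>. exp (A_fun \<epsilon>) / qtail (exp (- \<epsilon>)) 0) \<longlongrightarrow> 1) (at_right 0)"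
proof -
  \<comment> \<open>Besides the limit of the sums, Tannery's theorem yields summability of the
    limiting terms, the hypothesis of \<open>ln_midpoint_error_sums\<close>.\<close>
  have T: "eventually (\<lambda>\<epsilon>. summable (\<lambda>k. norm (euler_midpoint_error k \<epsilon>))) (at_right 0) \<and>
      summable (\<lambda>k. norm (ln_midpoint_error k)) \<and>
      ((\<lambda>\<epsilon>. \<Sum>k. euler_midpoint_error k \<epsilon>) \<longlongrightarrow> suminf ln_midpoint_error) (at_right 0)"
  proof (rule tannerys_theorem)
    have "eventually (\<lambda>\<epsilon>::real. \<forall>k. norm (euler_midpoint_error k \<epsilon>) \<le> 1 / (real (Suc k))\<^sup>2) (at_right 0)"
      using eventually_at_right_less[of "0::real"]
      by eventually_elim (simp add: abs_euler_midpoint_error_le del: of_nat_Suc)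
    then show "eventually (\<lambda>(k, \<epsilon>). norm (euler_midpoint_error k \<epsilon>) \<le> 1 / (real (Suc k))\<^sup>2)
        (at_top \<times>\<^sub>F at_right 0)"
      unfolding eventually_prod_filter
      by (intro exI[of _ "\<lambda>_. True"] exI conjI) (assumption | auto)+
  qed (rule tendsto_euler_midpoint_error summable_inverse_squares_Suc trivial_limit_at_right_real)+
  have "suminf ln_midpoint_error = ln pi / 2 - 1 / 2"
    using T summable_norm_cancel by (intro ln_midpoint_error_sums) blast
  with T have lim: "((\<lambda>\<epsilon>. \<Sum>k. euler_midpoint_error k \<epsilon>) \<longlongrightarrow> ln pi / 2 - 1 / 2) (at_right 0)" by simp
  have E: "((\<lambda>\<epsilon>. dilog_exp_error (\<epsilon> / 2)) \<longlongrightarrow> 0) (at_right 0)"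
  proof -
    have "filterlim (\<lambda>\<epsilon>::real. \<epsilon> / 2) (at_right 0) (at_right 0)"
      by real_asymp
    from filterlim_compose[OF tendsto_dilog_exp_error this] show ?thesis .
  qed
  have "((\<lambda>\<epsilon>. exp (ln pi / 2 - 1 / 2 + dilog_exp_error (\<epsilon> / 2) / 2 - (\<Sum>k. euler_midpoint_error k \<epsilon>)))
      \<longlongrightarrow> exp (ln pi / 2 - 1 / 2 + 0 / 2 - (ln pi / 2 - 1 / 2))) (at_right 0)"
    by (intro tendsto_intros lim E) simp
  then have "((\<lambda>\<epsilon>. exp (ln pi / 2 - 1 / 2 + dilog_exp_error (\<epsilon> / 2) / 2 - (\<Sum>k. euler_midpoint_error k \<epsilon>)))
      \<longlongrightarrow> 1) (at_right 0)" by simp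
  then show ?thesis
  proof (rule Lim_transform_eventually)
    show "eventually (\<lambda>\<epsilon>. exp (ln pi / 2 - 1 / 2 + dilog_exp_error (\<epsilon> / 2) / 2 - (\<Sum>k. euler_midpoint_error k \<epsilon>))
        = exp (A_fun \<epsilon>) / qtail (exp (- \<epsilon>)) 0) (at_right 0)"
      using eventually_at_right_less[of "0::real"]
    proof eventually_elim
      case (elim \<epsilon>)
      \<comment> \<open>The integrals telescope along \<open>f\<close>, from \<open>f 0\<close> to
        the limit 0 supplied by the decay of the dilogarithm at infinity.\<close>
      define f where "f k = dilog_exp (\<epsilon> * (real k + 1/2)) / \<epsilon>" for k
      have "filterlim (\<lambda>k. \<epsilon> * (real k + 1/2)) at_top sequentially"
        using elim by real_asymp
      from tendsto_divide[OF filterlim_compose[OF tendsto_dilog_exp_at_top this] tendsto_const[of \<epsilon>]]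
      have "f \<longlonglongrightarrow> 0" using elim by (simp add: f_def[abs_def])
      then have "(\<lambda>k. f (Suc k) - f k) sums (0 - f 0)" by (rule telescope_sums)
      moreover have "(\<lambda>k. ln (1 - exp (- \<epsilon>) ^ (0 + 1 + k))) sums (\<Sum>k. ln (1 - exp (- \<epsilon>) ^ (0 + 1 + k)))"
        using elim by (intro summable_sums summable_ln_one_minus_power) auto
      ultimately have "(\<lambda>k. ln (1 - exp (- \<epsilon>) ^ (0 + 1 + k)) - (f (Suc k) - f k)) sums
          ((\<Sum>k. ln (1 - exp (- \<epsilon>) ^ (0 + 1 + k))) - (0 - f 0))"
        by (rule sums_diff[rotated])
      then have "(\<lambda>k. euler_midpoint_error k \<epsilon>) sums ((\<Sum>k. ln (1 - exp (- \<epsilon>) ^ (0 + 1 + k))) + f 0)"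
        by (simp add: euler_midpoint_error_def f_def diff_divide_distrib)
      then have 1: "(\<Sum>k. ln (1 - exp (- \<epsilon>) ^ (0 + 1 + k))) = (\<Sum>k. euler_midpoint_error k \<epsilon>) - f 0"
        using sums_unique by fastforce
      have "f 0 = (pi\<^sup>2 / 6) * (1 / \<epsilon>) + ln (\<epsilon> / 2) / 2 - 1 / 2 + dilog_exp_error (\<epsilon> / 2) / 2"
        using elim dilog_exp_eq[of "\<epsilon> / 2"] by (simp add: f_def field_simps)
      then show ?case
        using elim unfolding qtail_def 1 A_fun_def
        by (simp add: exp_diff[symmetric] ln_div ln_mult field_simps)
    qed
  qed
qed

section \<open>Sums over Gelfand-Zetlin patterns\<close>

text \<open>Each lattice point b owns the half-open box of side eps with lower corner eps (b - c),
  and \<open>P\<close> sends every point of that box to b. The offset \<open>c\<close> moves boxes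
  without changing their volume. Since \<open>G\<close> consists of extensional functions, b =
  \<open>P a\<close> is decided by the coordinates in \<open>I\<close>.\<close>

lemma has_bochner_integral_lattice_step:
  fixes f :: "('i \<Rightarrow> int) \<Rightarrow> 'b::{banach, second_countable_topology}" and c :: "'i \<Rightarrow> int"
  assumes I: "finite I" and G: "finite G" "G \<subseteq> extensional I" and \<epsilon>: "0 < \<epsilon>"
  defines "P \<equiv> \<lambda>a. \<lambda>i\<in>I. c i + \<lfloor>a i / \<epsilon>\<rfloor>"
  shows "has_bochner_integral (\<Pi>\<^sub>M i\<in>I. lborel) (\<lambda>a. if P a \<in> G then f (P a) else 0)
           (\<epsilon> ^ card I *\<^sub>R (\<Sum>b\<in>G. f b))"
proof -
  interpret product_sigma_finite "\<lambda>_. lborel :: real measure" by standard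
  define box where "box b = (\<Pi>\<^sub>E i\<in>I. {\<epsilon> * real_of_int (b i - c i)..<\<epsilon> * real_of_int (b i - c i) + \<epsilon>})" for b
  have sets: "box b \<in> sets (\<Pi>\<^sub>M i\<in>I. lborel)" for b
    unfolding box_def by (intro sets_PiM_I_finite I) auto
  have "emeasure (\<Pi>\<^sub>M i\<in>I. lborel) (box b) = ennreal (\<epsilon> ^ card I)" for b
    unfolding box_def using \<epsilon> I by (subst emeasure_PiM) (auto simp: ennreal_power)
  then have em: "emeasure (\<Pi>\<^sub>M i\<in>I. lborel) (box b) < \<infinity>" "measure (\<Pi>\<^sub>M i\<in>I. lborel) (box b) = \<epsilon> ^ card I" for b
    using \<epsilon> by (auto simp: measure_def)
  have "has_bochner_integral (\<Pi>\<^sub>M i\<in>I. lborel) (\<lambda>a. \<Sum>b\<in>G. indicator (box b) a *\<^sub>R f b)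
      (\<Sum>b\<in>G. (\<epsilon> ^ card I) *\<^sub>R f b)"
  proof (intro has_bochner_integral_sum has_bochner_integral_scaleR_left)
    fix b
    show "has_bochner_integral (\<Pi>\<^sub>M i\<in>I. lborel) (indicator (box b)) (\<epsilon> ^ card I)"
      using has_bochner_integral_real_indicator[OF sets em(1), of b] by (simp add: em(2))
  qed
  moreover have "(\<Sum>b\<in>G. indicator (box b) a *\<^sub>R f b) = (if P a \<in> G then f (P a) else 0)"
    if "a \<in> space (\<Pi>\<^sub>M i\<in>I. lborel)" for a
  proof -
    have ext: "a \<in> extensional I" using that by (auto simp: space_PiM PiE_def)
    have mem: "a \<in> box b \<longleftrightarrow> b = P a" if "b \<in> G" for b
    proof -
      have "b \<in> extensional I" using that G by auto
      then have "b = P a \<longleftrightarrow> (\<forall>i\<in>I. b i = c i + \<lfloor>a i / \<epsilon>\<rfloor>)"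
        by (auto simp: P_def fun_eq_iff extensional_def)
      also have "\<dots> \<longleftrightarrow> (\<forall>i\<in>I. \<lfloor>a i / \<epsilon>\<rfloor> = b i - c i)" by auto
      also have "\<dots> \<longleftrightarrow> a \<in> box b"
      proof -
        have "\<lfloor>t / \<epsilon>\<rfloor> = n \<longleftrightarrow> \<epsilon> * real_of_int n \<le> t \<and> t < \<epsilon> * real_of_int n + \<epsilon>" for t n
          using \<epsilon> by (simp add: floor_eq_iff pos_le_divide_eq pos_divide_less_eq algebra_simps)
        then show ?thesis using ext by (simp add: box_def PiE_iff)
      qed
      finally show ?thesis by simp
    qed
    have "(\<Sum>b\<in>G. indicator (box b) a *\<^sub>R f b) = (\<Sum>b\<in>G. if b = P a then f b else 0)"
      by (intro sum.cong refl) (auto simp: indicator_def mem)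
    also have "\<dots> = (if P a \<in> G then f (P a) else 0)"
      using G(1) by (simp add: sum.delta)
    finally show ?thesis .
  qed
  ultimately show ?thesis
    by (subst (asm) has_bochner_integral_cong[OF refl _ refl]) (auto simp: scaleR_sum_right)
qed

lemma finite_gt_index [simp]: "finite (gt_index l)"
  by (simp add: gt_index_def)

lemma mem_gt_index: "(k, i) \<in> gt_index l \<longleftrightarrow> 1 \<le> k \<and> k \<le> l \<and> 1 \<le> i \<and> i \<le> k"
  by (auto simp: gt_index_def)

lemma card_gt_index: "card (gt_index l) = l * (l + 1) div 2"
  using gauss_sum_from_Suc_0[of l, where 'a = nat] by (simp add: gt_index_def)

text \<open>Every entry lies between two entries of the row above, so the bound on the fixed top row
  descends through the triangle. Finiteness matters because \<open>sum\<close> over an infinite set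
  is 0.\<close>

lemma finite_gz_patterns: "finite (gz_patterns l p)"
proof (rule finite_subset)
  define M where "M = (\<Sum>i=1..l+1. \<bar>p i\<bar>)"
  show "gz_patterns l p \<subseteq> (\<Pi>\<^sub>E _\<in>gt_index l. {-M..M})"
  proof
    fix b assume b: "b \<in> gz_patterns l p"
    have "\<forall>i\<in>{1..k}. \<bar>with_top l p b k i\<bar> \<le> M" if "1 \<le> k" "k \<le> l + 1" for k
      using that(2,1)
    proof (induction k rule: inc_induct)
      case base
      then show ?case
        by (auto simp: with_top_def M_def simp del: sum.cl_ivl_Suc intro!: member_le_sum)
    next
      case (step k)
      show ?case
      proof
        fix i assume i: "i \<in> {1..k}"
        have "with_top l p b (k + 1) i \<ge> with_top l p b k i"
          "with_top l p b k i \<ge> with_top l p b (k + 1) (i + 1)"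
          using b step.hyps step.prems i by (auto simp: gz_patterns_def)
        moreover have "\<bar>with_top l p b (k + 1) i\<bar> \<le> M" "\<bar>with_top l p b (k + 1) (i + 1)\<bar> \<le> M"
          using step i by auto
        ultimately show "\<bar>with_top l p b k i\<bar> \<le> M" by linarith
      qed
    qed
    then have "\<bar>b (k, i)\<bar> \<le> M" if "(k, i) \<in> gt_index l" for k i
      using that by (fastforce simp: mem_gt_index with_top_def)
    then have "b ki \<in> {-M..M}" if "ki \<in> gt_index l" for ki
      using that by (cases ki) (fastforce simp: abs_le_iff)
    then show "b \<in> (\<Pi>\<^sub>E _\<in>gt_index l. {-M..M})"
      using b by (auto simp: PiE_iff gz_patterns_def)
  qed
qed (simp add: finite_PiE)

section \<open>Separating the Euler factors from the weight\<close>

text \<open>What is left of \<open>gz_weight\<close> when every factorial is written as (q)_oo over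
  its tail product and the Euler factors are removed; hence numerator and denominator trade
  places.\<close>

definition tail_weight :: "real \<Rightarrow> nat \<Rightarrow> (nat \<Rightarrow> nat \<Rightarrow> int) \<Rightarrow> real" where
  "tail_weight q l P = (\<Prod>k=1..l.
     (\<Prod>i=1..k. qtail q (nat (P (k + 1) i - P k i)) * qtail q (nat (P k i - P (k + 1) (i + 1)))) /
     (\<Prod>i=1..k-1. qtail q (nat (P k i - P k (i + 1)))))"

lemma prod_power_Suc_eq: "(\<Prod>k=1..l. c ^ (k + 1)) = (c :: real) ^ (l * (l + 3) div 2)"
proof -
  have "(\<Sum>k=1..l. k + 1) = l * (l + 3) div 2"
  proof (induction l)
    case (Suc l)
    have "Suc l * (Suc l + 3) = l * (l + 3) + (l + 2) * 2" by (simp add: algebra_simps)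
    then have "Suc l * (Suc l + 3) div 2 = l * (l + 3) div 2 + (l + 2)"
      by (simp only: div_mult_self3[of 2] mult.commute[of _ 2]) simp
    with Suc show ?case by (simp del: mult_Suc mult_Suc_right)
  qed simp
  then show ?thesis using power_sum[of c "\<lambda>k. k + 1" "{1..l}"] by simp
qed

text \<open>In row k there are 2 k factorials below and k - 1 above, which leaves
  \<open>E ^ (k + 1)\<close> in the denominator. Row 1 has no factorial above, so the numerator may
  start at k = 1 as well.\<close>

lemma gz_weight_eq:
  assumes q: "0 < q" "q < 1"
  shows "gz_weight q l P = tail_weight q l P / qtail q 0 ^ (l * (l + 3) div 2)"
proof -
  define E where "E = qtail q 0"
  define G where "G d = qtail q (nat d)" for d :: int
  have pos: "E > 0" "G d > 0" for d using qtail_pos[OF q] by (auto simp: E_def G_def)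
  let ?N = "\<lambda>k. \<Prod>i=1..k-1. qfact q (nat (P k i - P k (i + 1)))"
  have "(\<Prod>k=2..l. ?N k) = (\<Prod>k=1..l. ?N k)"
    by (intro prod.mono_neutral_left) (auto simp: not_le numeral_2_eq_2 less_Suc_eq_le)
  then have "gz_weight q l P = (\<Prod>k=1..l. ?N k) /
     (\<Prod>k=1..l. \<Prod>i=1..k. qfact q (nat (P (k + 1) i - P k i)) * qfact q (nat (P k i - P (k + 1) (i + 1))))"
    by (simp add: gz_weight_def)
  also have "\<dots> = (\<Prod>k=1..l. ?N k /
     (\<Prod>i=1..k. qfact q (nat (P (k + 1) i - P k i)) * qfact q (nat (P k i - P (k + 1) (i + 1)))))"
    by (simp add: prod_dividef)
  also have "\<dots> = (\<Prod>k=1..l. ((\<Prod>i=1..k. G (P (k + 1) i - P k i) * G (P k i - P (k + 1) (i + 1))) /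
     (\<Prod>i=1..k-1. G (P k i - P k (i + 1)))) / E ^ (k + 1))"
  proof (intro prod.cong refl)
    fix k assume k: "k \<in> {1..l}"
    have N: "?N k = E ^ (k - 1) / (\<Prod>i=1..k-1. G (P k i - P k (i + 1)))"
      by (simp add: qfact_eq[OF q] E_def[symmetric] G_def[symmetric] prod_dividef)
    have D: "(\<Prod>i=1..k. qfact q (nat (P (k + 1) i - P k i)) * qfact q (nat (P k i - P (k + 1) (i + 1)))) =
        E ^ (2 * k) / (\<Prod>i=1..k. G (P (k + 1) i - P k i) * G (P k i - P (k + 1) (i + 1)))"
      by (simp add: qfact_eq[OF q] E_def[symmetric] G_def[symmetric] prod_dividef power_mult power2_eq_square)
    have "E ^ (2 * k) = E ^ (k - 1) * E ^ (k + 1)"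
      using k by (subst power_add[symmetric]) (auto intro: arg_cong[where f = "\<lambda>n. E ^ n"])
    then show "?N k / (\<Prod>i=1..k. qfact q (nat (P (k + 1) i - P k i)) * qfact q (nat (P k i - P (k + 1) (i + 1)))) =
      ((\<Prod>i=1..k. G (P (k + 1) i - P k i) * G (P k i - P (k + 1) (i + 1))) /
       (\<Prod>i=1..k-1. G (P k i - P k (i + 1)))) / E ^ (k + 1)"
      unfolding N D using pos(1) by (simp add: divide_simps)
  qed
  also have "\<dots> = tail_weight q l P / E ^ (l * (l + 3) div 2)"
    unfolding prod_dividef prod_power_Suc_eq by (simp add: tail_weight_def G_def prod_dividef)
  finally show ?thesis by (simp add: E_def)
qed

text \<open>The numerator factor of the pair \<open>(i, i + 1)\<close> is absorbed by the neighbouring factors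
  \<open>v i\<close> and \<open>u (i + 1)\<close> of the denominator, at the cost of taking square roots.\<close>

lemma prod_interlacing_le:
  fixes u v w :: "nat \<Rightarrow> real"
  assumes u: "\<And>i. 0 \<le> u i" "\<And>i. u i \<le> 1" and v: "\<And>i. 0 \<le> v i" "\<And>i. v i \<le> 1"
    and w: "\<And>i. 0 < w i"
    and le: "\<And>i. 1 \<le> i \<Longrightarrow> i < k \<Longrightarrow> v i * u (i + 1) / w i \<le> sqrt (v i) * sqrt (u (i + 1))"
    and k: "1 \<le> k"
  shows "(\<Prod>i=1..k. u i * v i) / (\<Prod>i=1..k-1. w i) \<le> (\<Prod>i=1..k. sqrt (u i) * sqrt (v i))"
proof -
  \<comment> \<open>Shifting one family by an index pairs \<open>g i\<close> with
    \<open>f (i + 1)\<close>, the two neighbours of the gap between i and i + 1; only the outermost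
    factors stay single.\<close>
  have rearrange: "(\<Prod>i=1..k. f i * g i) = f 1 * g k * (\<Prod>i=1..k-1. g i * f (i + 1))"
    for f g :: "nat \<Rightarrow> real"
    using k
  proof (induction k rule: dec_induct)
    case (step n)
    then have "(\<Prod>i=1..Suc n. f i * g i) = f 1 * g (Suc n) * ((\<Prod>i=1..n-1. g i * f (i + 1)) * (g n * f (Suc n)))"
      by simp
    also have "(\<Prod>i=1..n-1. g i * f (i + 1)) * (g n * f (Suc n)) = (\<Prod>i=1..n. g i * f (i + 1))"
      using step.hyps by (cases n) auto
    finally show ?case by simp
  qed simp
  \<comment> \<open>For the two single factors at the ends, which no divisor meets.\<close>
  have root: "t \<le> sqrt t" if "0 \<le> t" "t \<le> 1" for t :: real
    using that by (simp add: real_le_rsqrt power2_eq_square mult_left_le)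
  have "(\<Prod>i=1..k. u i * v i) / (\<Prod>i=1..k-1. w i) = u 1 * v k * (\<Prod>i=1..k-1. v i * u (i + 1) / w i)"
    by (subst rearrange) (simp add: prod_dividef)
  also have "\<dots> \<le> (sqrt (u 1) * sqrt (v k)) * (\<Prod>i=1..k-1. sqrt (v i) * sqrt (u (i + 1)))"
    using u v w by (intro mult_mono prod_mono root conjI le divide_nonneg_pos mult_nonneg_nonneg prod_nonneg)
      (auto intro!: divide_nonneg_pos)
  also have "\<dots> = (\<Prod>i=1..k. sqrt (u i) * sqrt (v i))"
    by (subst rearrange) simp
  finally show ?thesis .
qed

lemma tail_weight_nonneg:
  assumes "0 < q" "q < 1"
  shows "0 \<le> tail_weight q l P"
  unfolding tail_weight_def
  by (intro prod_nonneg divide_nonneg_nonneg mult_nonneg_nonneg ballI less_imp_le qtail_pos assms)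

text \<open>The difference of neighbours in row k splits at the entry
  \<open>P (k + 1) (i + 1)\<close> lying between them into two interlacing differences. Both are
  nonnegative, so \<open>nat\<close> is additive there and \<open>qtail_mult_le\<close>
  applies.\<close>

lemma tail_weight_le:
  assumes q: "0 < q" "q < 1"
    and P: "\<And>k i. 1 \<le> k \<Longrightarrow> k \<le> l \<Longrightarrow> 1 \<le> i \<Longrightarrow> i \<le> k \<Longrightarrow> P k i \<le> P (k + 1) i \<and> P (k + 1) (i + 1) \<le> P k i"
  shows "tail_weight q l P \<le> (\<Prod>k=1..l. \<Prod>i=1..k.
     sqrt (qtail q (nat (P (k + 1) i - P k i))) * sqrt (qtail q (nat (P k i - P (k + 1) (i + 1)))))"
  unfolding tail_weight_def
proof (intro prod_mono conjI)
  fix k assume k: "k \<in> {1..l}"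
  show "0 \<le> (\<Prod>i=1..k. qtail q (nat (P (k + 1) i - P k i)) * qtail q (nat (P k i - P (k + 1) (i + 1)))) /
     (\<Prod>i=1..k-1. qtail q (nat (P k i - P k (i + 1))))"
    by (intro prod_nonneg divide_nonneg_nonneg mult_nonneg_nonneg ballI less_imp_le qtail_pos q)
  show "(\<Prod>i=1..k. qtail q (nat (P (k + 1) i - P k i)) * qtail q (nat (P k i - P (k + 1) (i + 1)))) /
     (\<Prod>i=1..k-1. qtail q (nat (P k i - P k (i + 1))))
     \<le> (\<Prod>i=1..k. sqrt (qtail q (nat (P (k + 1) i - P k i))) * sqrt (qtail q (nat (P k i - P (k + 1) (i + 1)))))"
  proof (rule prod_interlacing_le)
    fix i assume i: "1 \<le> i" "i < k"
    have "P k i - P k (i + 1) = (P k i - P (k + 1) (i + 1)) + (P (k + 1) (i + 1) - P k (i + 1))" by simp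
    moreover have "0 \<le> P k i - P (k + 1) (i + 1)" "0 \<le> P (k + 1) (i + 1) - P k (i + 1)"
      using P[of k i] P[of k "i + 1"] i k by auto
    ultimately have "nat (P k i - P k (i + 1)) = nat (P k i - P (k + 1) (i + 1)) + nat (P (k + 1) (i + 1) - P k (i + 1))"
      by (simp only: nat_add_distrib)
    then show "qtail q (nat (P k i - P (k + 1) (i + 1))) * qtail q (nat (P (k + 1) (i + 1) - P k (i + 1))) /
        qtail q (nat (P k i - P k (i + 1)))
      \<le> sqrt (qtail q (nat (P k i - P (k + 1) (i + 1)))) * sqrt (qtail q (nat (P (k + 1) (i + 1) - P k (i + 1))))"
      using qtail_mult_le[OF q] by simp
  qed (use q k in \<open>auto intro: qtail_pos qtail_le_one less_imp_le\<close>)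
qed

section \<open>Integrability of the Givental integrand\<close>

definition pattern_norm :: "nat \<Rightarrow> (nat \<Rightarrow> nat \<Rightarrow> real) \<Rightarrow> real" where
  "pattern_norm l Y = (\<Sum>k=1..l+1. \<Sum>i=1..k. \<bar>Y k i\<bar>)"

definition spectral_factor :: "nat \<Rightarrow> (nat \<Rightarrow> complex) \<Rightarrow> (nat \<Rightarrow> nat \<Rightarrow> real) \<Rightarrow> complex" where
  "spectral_factor l lam Y =
     exp (\<i> * (\<Sum>n=1..l+1. lam n * complex_of_real ((\<Sum>i=1..n. Y n i) - (\<Sum>i=1..n-1. Y (n - 1) i))))"

definition toda_potential :: "nat \<Rightarrow> (nat \<Rightarrow> nat \<Rightarrow> real) \<Rightarrow> real" where
  "toda_potential l Y = (\<Sum>k=1..l. \<Sum>i=1..k.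
       exp (Y k i - Y (k + 1) i) + exp (Y (k + 1) (i + 1) - Y k i))"

lemma givental_integrand_eq:
  "givental_integrand l lam x a =
     spectral_factor l lam (with_top l x a) * complex_of_real (exp (- toda_potential l (with_top l x a)))"
  by (simp add: givental_integrand_def givental_action_def spectral_factor_def toda_potential_def
      exp_diff exp_minus divide_inverse exp_of_real[symmetric] del: of_real_diff of_real_sum of_real_add)

text \<open>For complex \<open>lam\<close> the factor is not unimodular, but it grows at most
  exponentially; the 2 accounts for the two row sums in each exponent.\<close>

lemma norm_spectral_factor_le:
  "norm (spectral_factor l lam Y) \<le> exp (2 * (\<Sum>n=1..l+1. norm (lam n)) * pattern_norm l Y)"
proof -
  have row: "(\<Sum>i=1..n. \<bar>Y n i\<bar>) \<le> pattern_norm l Y" if "n \<le> l + 1" for n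
  proof (cases "n = 0")
    case True
    then show ?thesis by (auto simp: pattern_norm_def simp del: sum.cl_ivl_Suc intro!: sum_nonneg)
  next
    case False
    then show ?thesis using that unfolding pattern_norm_def
      by (intro member_le_sum[of n _ "\<lambda>n. \<Sum>i=1..n. \<bar>Y n i\<bar>"]) (auto intro!: sum_nonneg)
  qed
  have diff: "\<bar>(\<Sum>i=1..n. Y n i) - (\<Sum>i=1..n-1. Y (n - 1) i)\<bar> \<le> 2 * pattern_norm l Y" if "n \<le> l + 1" for n
    using row[of n] row[of "n - 1"] that sum_abs[of "Y n" "{1..n}"] sum_abs[of "Y (n - 1)" "{1..n-1}"]
    by linarith
  let ?s = "\<Sum>n=1..l+1. lam n * complex_of_real ((\<Sum>i=1..n. Y n i) - (\<Sum>i=1..n-1. Y (n - 1) i))"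
  have "norm (spectral_factor l lam Y) \<le> exp (norm (\<i> * ?s))"
    unfolding spectral_factor_def by (rule norm_exp)
  also have "norm (\<i> * ?s) \<le> (\<Sum>n=1..l+1. norm (lam n) * (2 * pattern_norm l Y))"
    unfolding norm_mult norm_ii mult_1
    by (rule sum_norm_le)
       (use diff in \<open>auto simp: norm_mult simp del: of_real_diff intro!: mult_left_mono\<close>)
  also have "\<dots> = 2 * (\<Sum>n=1..l+1. norm (lam n)) * pattern_norm l Y"
    by (simp add: sum_distrib_right sum_distrib_left mult_ac del: sum.cl_ivl_Suc)
  finally show ?thesis by simp
qed

text \<open>An exponential beats any linear function, and the entries of a triangular array are controlled
  by its top row and by the positive parts of the differences occurring in the potential.\<close>

lemma pattern_norm_le_toda_potential:
  fixes x :: "nat \<Rightarrow> real"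
  assumes B: "0 \<le> B" and c: "0 < c"
  obtains C where "\<And>a. B * pattern_norm l (with_top l x a) - c * toda_potential l (with_top l x a) \<le> C"
proof -
  define n where "n = (\<Sum>k=1..l+1. real k)"
  define M where "M = (\<Sum>i=1..l+1. \<bar>x i\<bar>)"
  define K where "K = B * n"
  \<comment> \<open>The constant from completing the square in K d <= c d^2 / 2 + K^2 / (2
    c).\<close>
  define D where "D = K\<^sup>2 / (2 * c)"
  have n: "0 \<le> n" by (simp add: n_def sum_nonneg del: sum.cl_ivl_Suc)
  have K: "0 \<le> K" using B n by (simp add: K_def)
  have lin: "K * max 0 d \<le> c * exp d + D" for d
  proof (cases "0 \<le> d")
    case True
    have "0 \<le> (c * d - K)\<^sup>2 / (2 * c)" using c by simp
    then have "K * d \<le> c * (d\<^sup>2 / 2) + D"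
      using c by (simp add: D_def power2_eq_square field_simps)
    also have "\<dots> \<le> c * exp d + D"
    proof -
      have "d\<^sup>2 / 2 \<le> exp d" using exp_lower_Taylor_quadratic[OF True] True by linarith
      then show ?thesis using c by simp
    qed
    finally show ?thesis using True by simp
  next
    case False
    then show ?thesis using c by (simp add: D_def add_nonneg_nonneg)
  qed
  show ?thesis
  proof
    fix a
    define Y where "Y = with_top l x a"
    \<comment> \<open>Measures how far rows k and k + 1 are from interlacing. Descending one row
      enlarges the bound on the entries by at most this amount.\<close>
    define v where "v k = (\<Sum>i=1..k. max 0 (Y k i - Y (k + 1) i) + max 0 (Y (k + 1) (i + 1) - Y k i))" for k
    have v: "0 \<le> v k" for k by (simp add: v_def sum_nonneg)
    have entry: "\<forall>i\<in>{1..k}. \<bar>Y k i\<bar> \<le> M + (\<Sum>j=k..l. v j)" if "1 \<le> k" "k \<le> l + 1" for k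
      using that(2,1)
    proof (induction k rule: inc_induct)
      case base
      then show ?case
        by (auto simp: Y_def with_top_def M_def simp del: sum.cl_ivl_Suc intro!: member_le_sum)
    next
      case (step k)
      show ?case
      proof
        fix i assume i: "i \<in> {1..k}"
        have "max 0 (Y k i - Y (k + 1) i) + max 0 (Y (k + 1) (i + 1) - Y k i) \<le> v k"
          unfolding v_def using i
          by (intro member_le_sum[where f = "\<lambda>i. max 0 (Y k i - Y (k + 1) i) + max 0 (Y (k + 1) (i + 1) - Y k i)"]) auto
        moreover have "\<bar>Y (k + 1) i\<bar> \<le> M + (\<Sum>j=Suc k..l. v j)" "\<bar>Y (k + 1) (i + 1)\<bar> \<le> M + (\<Sum>j=Suc k..l. v j)"
          using step i by auto
        moreover have "(\<Sum>j=k..l. v j) = v k + (\<Sum>j=Suc k..l. v j)"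
          using step.hyps by (simp add: sum.atLeast_Suc_atMost)
        ultimately show "\<bar>Y k i\<bar> \<le> M + (\<Sum>j=k..l. v j)" by linarith
      qed
    qed
    have sub: "(\<Sum>j=k..l. v j) \<le> (\<Sum>j=1..l. v j)" if "1 \<le> k" for k
      using that v by (intro sum_mono2) auto
    have "pattern_norm l Y \<le> (\<Sum>k=1..l+1. \<Sum>i=1..k. M + (\<Sum>j=1..l. v j))"
      unfolding pattern_norm_def
    proof (intro sum_mono)
      fix k i assume "k \<in> {1..l+1}" "i \<in> {1..k}"
      then show "\<bar>Y k i\<bar> \<le> M + (\<Sum>j=1..l. v j)" using entry[of k] sub[of k] by fastforce
    qed
    also have "\<dots> = n * (M + (\<Sum>j=1..l. v j))"
      by (simp add: n_def sum_distrib_right del: sum.cl_ivl_Suc)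
    finally have "B * pattern_norm l Y \<le> B * (n * (M + (\<Sum>j=1..l. v j)))"
      using B by (rule mult_left_mono)
    also have "\<dots> = K * M + (\<Sum>j=1..l. K * v j)"
      by (simp add: K_def sum_distrib_left algebra_simps)
    also have "(\<Sum>j=1..l. K * v j) \<le> (\<Sum>k=1..l. \<Sum>i=1..k.
        c * (exp (Y k i - Y (k + 1) i) + exp (Y (k + 1) (i + 1) - Y k i)) + 2 * D)"
      unfolding v_def sum_distrib_left
      by (intro sum_mono) (use lin in \<open>smt (verit) distrib_left\<close>)
    also have "\<dots> = c * toda_potential l Y + (\<Sum>k=1..l. \<Sum>i=1..k. 2 * D)"
      by (simp add: toda_potential_def sum.distrib sum_distrib_left distrib_left)
    finally show "B * pattern_norm l (with_top l x a) - c * toda_potential l (with_top l x a)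
        \<le> K * M + (\<Sum>k=1..l. \<Sum>i=1..k. 2 * D)"
      by (simp add: Y_def)
  qed
qed

text \<open>A product of Laplace densities up to normalisation: an integrable majorant that depends
  neither on the top row nor on eps.\<close>

definition array_envelope :: "nat \<Rightarrow> (nat \<times> nat \<Rightarrow> real) \<Rightarrow> real" where
  "array_envelope l a = (\<Prod>ki\<in>gt_index l. exp (- \<bar>a ki\<bar>))"

lemma integrable_exp_minus_abs: "integrable lborel (\<lambda>t::real. exp (- \<bar>t\<bar>))"
proof -
  define h where "h t = indicator {0..} t *\<^sub>R exp (- t)" for t :: real
  have "integrable lebesgue h"
    using integrable_on_exp_minus_to_infinity[of 1 0] unfolding h_def
    by (intro nonnegative_absolutely_integrable_1 [unfolded set_integrable_def]) auto
  then have h: "integrable lborel h"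
    by (subst (asm) integrable_completion) (auto simp: h_def[abs_def])
  then have "integrable lborel (\<lambda>t. h (0 + (- 1) * t))"
    by (intro lborel_integrable_real_affine) auto
  with h have "integrable lborel (\<lambda>t. h t + h (- t))"
    by (intro Bochner_Integration.integrable_add) simp_all
  then show ?thesis
    by (rule Bochner_Integration.integrable_bound) (auto simp: h_def indicator_def)
qed

lemma integrable_array_envelope: "integrable (array_lborel l) (array_envelope l)"
proof -
  interpret product_sigma_finite "\<lambda>_. lborel :: real measure" by standard
  show ?thesis unfolding array_lborel_def array_envelope_def
    by (intro product_integrable_prod integrable_exp_minus_abs finite_gt_index)
qed

text \<open>The potential also dominates (B + 1) copies of the norm, and the additional copy
  supplies the decay of the envelope. Any c > 0 is allowed because the majorant of the rescaled sums
  retains only a small fraction of the potential.\<close>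

lemma exp_pattern_norm_le_array_envelope:
  assumes B: "0 \<le> B" and c: "0 < c"
  obtains C where "\<And>a. exp (B * pattern_norm l (with_top l x a)) * exp (- c * toda_potential l (with_top l x a))
      \<le> C * array_envelope l a"
proof -
  obtain C where C: "\<And>a. (B + 1) * pattern_norm l (with_top l x a) - c * toda_potential l (with_top l x a) \<le> C"
    using pattern_norm_le_toda_potential[of "B + 1" c] B c by auto
  show ?thesis
  proof
    fix a
    have "(\<Sum>ki\<in>gt_index l. \<bar>a ki\<bar>) = (\<Sum>k=1..l. \<Sum>i=1..k. \<bar>with_top l x a k i\<bar>)"
      unfolding gt_index_def by (subst sum.Sigma) (auto simp: with_top_def intro!: sum.cong)
    also have "\<dots> \<le> pattern_norm l (with_top l x a)"
      unfolding pattern_norm_def by (intro sum_mono2) (auto intro!: sum_nonneg)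
    finally have "B * pattern_norm l (with_top l x a) - c * toda_potential l (with_top l x a)
        \<le> C - (\<Sum>ki\<in>gt_index l. \<bar>a ki\<bar>)"
      using C[of a] by (simp add: algebra_simps)
    then have "exp (B * pattern_norm l (with_top l x a) - c * toda_potential l (with_top l x a))
        \<le> exp (C - (\<Sum>ki\<in>gt_index l. \<bar>a ki\<bar>))" by simp
    then show "exp (B * pattern_norm l (with_top l x a)) * exp (- c * toda_potential l (with_top l x a))
      \<le> exp C * array_envelope l a"
      by (simp add: array_envelope_def exp_diff exp_minus exp_sum prod_inversef[symmetric] divide_inverse)
  qed
qed

lemma measurable_with_top:
  assumes "1 \<le> i" "i \<le> k" "1 \<le> k" "k \<le> l + 1"
  shows "(\<lambda>a. with_top l x a k i) \<in> borel_measurable (array_lborel l)"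
proof (cases "k = l + 1")
  case False
  then have "(k, i) \<in> gt_index l" using assms by (auto simp: mem_gt_index)
  then have "(\<lambda>a. a (k, i)) \<in> measurable (array_lborel l) lborel"
    unfolding array_lborel_def by (rule measurable_component_singleton)
  with False show ?thesis by (simp add: with_top_def)
qed (simp add: with_top_def)

lemma measurable_givental_integrand:
  "givental_integrand l lam x \<in> borel_measurable (array_lborel l)"
proof -
  have "(\<lambda>a. spectral_factor l lam (with_top l x a) *
      complex_of_real (exp (- toda_potential l (with_top l x a)))) \<in> borel_measurable (array_lborel l)"
    unfolding spectral_factor_def toda_potential_def
    by (intro borel_measurable_times borel_measurable_sum borel_measurable_add borel_measurable_diff
        borel_measurable_const borel_measurable_uminus
        measurable_compose[OF _ borel_measurable_exp]
        measurable_compose[OF _ borel_measurable_of_real] measurable_with_top)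
      (auto simp del: of_real_diff)
  then show ?thesis by (simp add: givental_integrand_eq[abs_def])
qed

lemma integrable_givental_integrand: "integrable (array_lborel l) (givental_integrand l lam x)"
proof -
  obtain C where C: "\<And>a. exp (2 * (\<Sum>n=1..l+1. norm (lam n)) * pattern_norm l (with_top l x a)) *
      exp (- 1 * toda_potential l (with_top l x a)) \<le> C * array_envelope l a"
    using exp_pattern_norm_le_array_envelope[of "2 * (\<Sum>n=1..l+1. norm (lam n))" 1]
    by (auto simp: sum_nonneg simp del: sum.cl_ivl_Suc)
  show ?thesis
  proof (rule Bochner_Integration.integrable_bound)
    show "integrable (array_lborel l) (\<lambda>a. C * array_envelope l a)"
      by (intro integrable_mult_right integrable_array_envelope)
    have "norm (givental_integrand l lam x a) \<le> norm (C * array_envelope l a)" for a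
    proof -
      have "norm (givental_integrand l lam x a) \<le>
        exp (2 * (\<Sum>n=1..l+1. norm (lam n)) * pattern_norm l (with_top l x a)) *
        exp (- 1 * toda_potential l (with_top l x a))"
        unfolding givental_integrand_eq norm_mult
        by (intro mult_mono norm_spectral_factor_le) auto
      also note C
      finally show ?thesis by simp
    qed
    then show "AE a in array_lborel l. norm (givental_integrand l lam x a) \<le> norm (C * array_envelope l a)"
      by simp
  qed (rule measurable_givental_integrand)
qed

section \<open>The limit\<close>

text \<open>Rounding changes ln eps / eps by less than 1, hence eps m differs from -ln eps by at
  most eps.\<close>

lemma exp_m_shift_bounds:
  assumes "0 < \<epsilon>"
  shows "exp (- (\<epsilon> * m_shift \<epsilon>)) \<le> \<epsilon>" "\<epsilon> * exp (- \<epsilon>) \<le> exp (- (\<epsilon> * m_shift \<epsilon>))"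
proof -
  have m: "real_of_int (m_shift \<epsilon>) = - real_of_int \<lfloor>ln \<epsilon> / \<epsilon>\<rfloor>" by (simp add: m_shift_def)
  have "\<epsilon> * real_of_int \<lfloor>ln \<epsilon> / \<epsilon>\<rfloor> \<le> \<epsilon> * (ln \<epsilon> / \<epsilon>)"
    using assms by (intro mult_left_mono) auto
  then have "- (\<epsilon> * m_shift \<epsilon>) \<le> ln \<epsilon>" using assms by (simp add: m)
  then have "exp (- (\<epsilon> * m_shift \<epsilon>)) \<le> exp (ln \<epsilon>)" by (simp only: exp_le_cancel_iff)
  then show "exp (- (\<epsilon> * m_shift \<epsilon>)) \<le> \<epsilon>" using assms by (simp only: exp_ln)
  have "\<epsilon> * (ln \<epsilon> / \<epsilon> - 1) \<le> \<epsilon> * real_of_int \<lfloor>ln \<epsilon> / \<epsilon>\<rfloor>"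
    using assms by (intro mult_left_mono) linarith+
  then have "ln \<epsilon> + - \<epsilon> \<le> - (\<epsilon> * m_shift \<epsilon>)" using assms by (simp add: m algebra_simps)
  then have "exp (ln \<epsilon> + - \<epsilon>) \<le> exp (- (\<epsilon> * m_shift \<epsilon>))" by (simp only: exp_le_cancel_iff)
  then show "\<epsilon> * exp (- \<epsilon>) \<le> exp (- (\<epsilon> * m_shift \<epsilon>))" using assms by (simp only: exp_add exp_ln)
qed

text \<open>The last factor \<open>exp (- \<epsilon>)\<close> comes from tail products starting at n
  + 1; the hypothesis on the sign of d keeps \<open>nat\<close> from truncating.\<close>

lemma exp_power_scaled:
  fixes d :: int
  assumes "0 < \<epsilon>" "0 \<le> d" "real_of_int d = real c * m_shift \<epsilon> + y / \<epsilon>"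
  shows "exp (- \<epsilon>) ^ (nat d + 1) = exp (- (\<epsilon> * m_shift \<epsilon>)) ^ c * exp (- y) * exp (- \<epsilon>)"
proof -
  have "exp (- \<epsilon>) ^ (nat d + 1) = exp (real (nat d + 1) * (- \<epsilon>))"
    by (rule exp_of_nat_mult[symmetric])
  also have "real (nat d + 1) * (- \<epsilon>) = real c * (- (\<epsilon> * m_shift \<epsilon>)) + (- y) + (- \<epsilon>)"
    using assms by (simp add: algebra_simps)
  also have "exp \<dots> = exp (- (\<epsilon> * m_shift \<epsilon>)) ^ c * exp (- y) * exp (- \<epsilon>)"
    by (simp only: exp_add exp_of_nat_mult)
  finally show ?thesis .
qed

lemma one_minus_exp_minus_le: "1 - exp (- \<epsilon>) \<le> (\<epsilon>::real)"
  using exp_ge_add_one_self[of "- \<epsilon>"] by linarith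

text \<open>Up to the factor 1/eps, the difference is at least -ln eps plus a convergent
  term.\<close>

lemma eventually_scaled_nonneg:
  fixes d :: "real \<Rightarrow> int"
  assumes d: "\<And>\<epsilon>. 0 < \<epsilon> \<Longrightarrow> real_of_int (d \<epsilon>) = real c * m_shift \<epsilon> + Y \<epsilon> / \<epsilon>"
    and Y: "(Y \<longlongrightarrow> y) (at_right 0)" and c: "1 \<le> c"
  shows "eventually (\<lambda>\<epsilon>. 0 \<le> d \<epsilon>) (at_right 0)"
proof -
  have "filterlim (\<lambda>\<epsilon>::real. - ln \<epsilon>) at_top (at_right 0)" by real_asymp
  from filterlim_tendsto_add_at_top[OF Y this]
  have "eventually (\<lambda>\<epsilon>. 0 \<le> Y \<epsilon> + - ln \<epsilon>) (at_right 0)"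
    unfolding filterlim_at_top by blast
  moreover have "eventually (\<lambda>\<epsilon>::real. \<epsilon> < 1) (at_right 0)" by real_asymp
  ultimately show ?thesis using eventually_at_right_less[of "0::real"]
  proof eventually_elim
    case (elim \<epsilon>)
    have "ln \<epsilon> / \<epsilon> \<le> 0" using elim by (simp add: divide_nonpos_pos)
    then have "- (ln \<epsilon> / \<epsilon>) \<le> m_shift \<epsilon>" "0 \<le> m_shift \<epsilon>"
      by (simp_all add: m_shift_def)
    moreover have "1 * real_of_int (m_shift \<epsilon>) \<le> real c * m_shift \<epsilon>"
      using c calculation(2) by (intro mult_right_mono) auto
    moreover have "0 \<le> (Y \<epsilon> - ln \<epsilon>) / \<epsilon>" using elim by simp
    ultimately have "0 \<le> real_of_int (d \<epsilon>)"
      using d[of \<epsilon>] elim by (simp add: diff_divide_distrib)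
    then show ?case by simp
  qed
qed

text \<open>Here c counts the copies of m in the difference. Interlacing differences have c = 1 and
  v = 1 and produce the double exponential; differences within a row have c = 2 and v = 0 and
  disappear in the limit.\<close>

lemma tendsto_qtail_scaled:
  fixes d :: "real \<Rightarrow> int"
  assumes d: "\<And>\<epsilon>. 0 < \<epsilon> \<Longrightarrow> real_of_int (d \<epsilon>) = real c * m_shift \<epsilon> + Y \<epsilon> / \<epsilon>"
    and Y: "(Y \<longlongrightarrow> y) (at_right 0)" and c: "1 \<le> c"
    and v: "((\<lambda>\<epsilon>. exp (- (\<epsilon> * m_shift \<epsilon>)) ^ c / \<epsilon>) \<longlongrightarrow> v) (at_right 0)"
  shows "((\<lambda>\<epsilon>. qtail (exp (- \<epsilon>)) (nat (d \<epsilon>))) \<longlongrightarrow> exp (- (v * exp (- y)))) (at_right 0)"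
proof (rule tendsto_qtail)
  have nonneg: "eventually (\<lambda>\<epsilon>. 0 \<le> d \<epsilon>) (at_right 0)"
    by (rule eventually_scaled_nonneg[OF _ Y c]) (rule d)
  have "((\<lambda>\<epsilon>::real. \<epsilon> * exp (- \<epsilon>) / (1 - exp (- \<epsilon>))) \<longlongrightarrow> 1) (at_right 0)"
    by real_asymp
  then have "((\<lambda>\<epsilon>. exp (- (\<epsilon> * m_shift \<epsilon>)) ^ c / \<epsilon> * exp (- Y \<epsilon>) * (\<epsilon> * exp (- \<epsilon>) / (1 - exp (- \<epsilon>))))
      \<longlongrightarrow> v * exp (- y) * 1) (at_right 0)"
    by (intro tendsto_intros v Y)
  then have "((\<lambda>\<epsilon>. exp (- (\<epsilon> * m_shift \<epsilon>)) ^ c / \<epsilon> * exp (- Y \<epsilon>) * (\<epsilon> * exp (- \<epsilon>) / (1 - exp (- \<epsilon>))))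
      \<longlongrightarrow> v * exp (- y)) (at_right 0)" by simp
  then show "((\<lambda>\<epsilon>. exp (- \<epsilon>) ^ (nat (d \<epsilon>) + 1) / (1 - exp (- \<epsilon>))) \<longlongrightarrow> v * exp (- y)) (at_right 0)"
  proof (rule Lim_transform_eventually)
    show "eventually (\<lambda>\<epsilon>. exp (- (\<epsilon> * m_shift \<epsilon>)) ^ c / \<epsilon> * exp (- Y \<epsilon>) * (\<epsilon> * exp (- \<epsilon>) / (1 - exp (- \<epsilon>))) =
        exp (- \<epsilon>) ^ (nat (d \<epsilon>) + 1) / (1 - exp (- \<epsilon>))) (at_right 0)"
      using nonneg eventually_at_right_less[of "0::real"]
    proof eventually_elim
      case (elim \<epsilon>)
      then show ?case
        by (subst exp_power_scaled[OF _ _ d]) auto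
    qed
  qed
qed

lemma tendsto_exp_m_shift_1: "((\<lambda>\<epsilon>. exp (- (\<epsilon> * m_shift \<epsilon>)) ^ 1 / \<epsilon>) \<longlongrightarrow> 1) (at_right 0)"
proof (rule tendsto_sandwich)
  show "((\<lambda>\<epsilon>::real. exp (- \<epsilon>)) \<longlongrightarrow> 1) (at_right 0)" by real_asymp
  show "eventually (\<lambda>\<epsilon>. exp (- \<epsilon>) \<le> exp (- (\<epsilon> * m_shift \<epsilon>)) ^ 1 / \<epsilon>) (at_right 0)"
    using eventually_at_right_less[of "0::real"]
    by eventually_elim (use exp_m_shift_bounds(2) in \<open>simp add: pos_le_divide_eq mult.commute\<close>)
  show "eventually (\<lambda>\<epsilon>. exp (- (\<epsilon> * m_shift \<epsilon>)) ^ 1 / \<epsilon> \<le> 1) (at_right 0)"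
    using eventually_at_right_less[of "0::real"]
    by eventually_elim (use exp_m_shift_bounds(1) in simp)
qed auto

lemma tendsto_exp_m_shift_2: "((\<lambda>\<epsilon>. exp (- (\<epsilon> * m_shift \<epsilon>)) ^ 2 / \<epsilon>) \<longlongrightarrow> 0) (at_right 0)"
proof (rule tendsto_sandwich)
  show "eventually (\<lambda>\<epsilon>. 0 \<le> exp (- (\<epsilon> * m_shift \<epsilon>)) ^ 2 / \<epsilon>) (at_right 0)"
    using eventually_at_right_less[of "0::real"] by eventually_elim auto
  show "eventually (\<lambda>\<epsilon>. exp (- (\<epsilon> * m_shift \<epsilon>)) ^ 2 / \<epsilon> \<le> \<epsilon>) (at_right 0)"
    using eventually_at_right_less[of "0::real"]
  proof eventually_elim
    case (elim \<epsilon>)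
    have "exp (- (\<epsilon> * m_shift \<epsilon>)) ^ 2 \<le> \<epsilon> ^ 2"
      using exp_m_shift_bounds(1)[OF elim] by (intro power_mono) auto
    then show ?case using elim by (simp add: pos_divide_le_eq power2_eq_square)
  qed
  show "((\<lambda>\<epsilon>::real. \<epsilon>) \<longlongrightarrow> 0) (at_right 0)" by real_asymp
qed auto

text \<open>The slack 2 allows each of the two entries in a difference to be off by 1. It costs
  exp(-2); for eps <= 1 the rounding of m and the exponent n + 1 cost at most another exp(-1) each,
  whence exp(-4). The square root halves the exponent.\<close>

lemma sqrt_qtail_scaled_le:
  fixes d :: int
  assumes \<epsilon>: "0 < \<epsilon>" "\<epsilon> \<le> 1" and d: "0 \<le> d" "real_of_int d = m_shift \<epsilon> + y / \<epsilon>"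
    and y: "y \<le> x + 2"
  shows "sqrt (qtail (exp (- \<epsilon>)) (nat d)) \<le> exp (- (exp (- 4) / 2) * exp (- x))"
proof -
  have "exp (- 4) * exp (- x) \<le> exp (- \<epsilon>) * exp (- y) * exp (- \<epsilon>)"
    using \<epsilon> y unfolding exp_add[symmetric] by simp
  also have "\<dots> = \<epsilon> * exp (- \<epsilon>) * exp (- y) * exp (- \<epsilon>) / \<epsilon>"
    using \<epsilon> by simp
  also have "\<dots> \<le> exp (- (\<epsilon> * m_shift \<epsilon>)) * exp (- y) * exp (- \<epsilon>) / (1 - exp (- \<epsilon>))"
    using \<epsilon> exp_m_shift_bounds(2)[OF \<epsilon>(1)] one_minus_exp_minus_le
    by (intro frac_le mult_right_mono) auto
  also have "\<dots> = exp (- \<epsilon>) ^ (nat d + 1) / (1 - exp (- \<epsilon>))"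
    using exp_power_scaled[of \<epsilon> d 1 y] \<epsilon> d by simp
  finally have "exp (- (exp (- \<epsilon>) ^ (nat d + 1) / (1 - exp (- \<epsilon>)))) \<le> exp (- (exp (- 4) * exp (- x)))"
    by simp
  moreover have "qtail (exp (- \<epsilon>)) (nat d) \<le> exp (- (exp (- \<epsilon>) ^ (nat d + 1) / (1 - exp (- \<epsilon>))))"
    by (rule qtail_le) (use \<epsilon> in auto)
  ultimately have "qtail (exp (- \<epsilon>)) (nat d) \<le> exp (- (exp (- 4) * exp (- x)))"
    by linarith
  also have "\<dots> = (exp (- (exp (- 4) / 2) * exp (- x)))\<^sup>2"
    by (simp flip: exp_double)
  finally show ?thesis by (intro real_le_lsqrt) auto
qed

section \<open>Step functions whose integrals are the rescaled sums\<close>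

text \<open>Extends the parametrization of the top row, where k = l + 1 gives l + 2 - 2 i, to the
  rows below, after rounding each coordinate down to the lattice of mesh eps.\<close>

definition lattice_pattern :: "nat \<Rightarrow> real \<Rightarrow> (nat \<times> nat \<Rightarrow> real) \<Rightarrow> nat \<times> nat \<Rightarrow> int" where
  "lattice_pattern l \<epsilon> a = (\<lambda>ki\<in>gt_index l. (int (fst ki) + 1 - 2 * int (snd ki)) * m_shift \<epsilon> + \<lfloor>a ki / \<epsilon>\<rfloor>)"

definition rescaled_pattern :: "real \<Rightarrow> (nat \<times> nat \<Rightarrow> real) \<Rightarrow> nat \<times> nat \<Rightarrow> real" where
  "rescaled_pattern \<epsilon> a ki = \<epsilon> * \<lfloor>a ki / \<epsilon>\<rfloor>"

lemma rescaled_pattern_diff_le: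
  assumes "0 < \<epsilon>"
  shows "\<bar>rescaled_pattern \<epsilon> a ki - a ki\<bar> \<le> \<epsilon>"
proof -
  have "\<epsilon> * (a ki / \<epsilon> - 1) \<le> \<epsilon> * \<lfloor>a ki / \<epsilon>\<rfloor>" "\<epsilon> * \<lfloor>a ki / \<epsilon>\<rfloor> \<le> \<epsilon> * (a ki / \<epsilon>)"
    using assms by (intro mult_left_mono; linarith)+
  then show ?thesis using assms by (simp add: rescaled_pattern_def algebra_simps)
qed

lemma tendsto_rescaled_pattern: "((\<lambda>\<epsilon>. rescaled_pattern \<epsilon> a ki) \<longlongrightarrow> a ki) (at_right 0)"
proof (rule Lim_null[THEN iffD2], rule tendsto_0_le[where K = 1])
  show "((\<lambda>\<epsilon>::real. \<epsilon>) \<longlongrightarrow> 0) (at_right 0)" by real_asymp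
  show "eventually (\<lambda>\<epsilon>. norm (rescaled_pattern \<epsilon> a ki - a ki) \<le> norm \<epsilon> * 1) (at_right 0)"
    using eventually_at_right_less[of "0::real"]
    by eventually_elim (use rescaled_pattern_diff_le in simp)
qed

lemma sum_pattern_center: "(\<Sum>i=1..k. real k + 1 - 2 * real i) = 0"
proof -
  have "(\<Sum>i=1..k. real i) = real k * (real k + 1) / 2"
    by (induction k) (auto simp: field_simps)
  moreover have "(\<Sum>i=1..k. real k + 1 - 2 * real i) = real k * (real k + 1) - 2 * (\<Sum>i=1..k. real i)"
    by (simp add: sum_subtractf sum_distrib_left)
  ultimately show ?thesis by simp
qed

context
  fixes l :: nat and lam :: "nat \<Rightarrow> complex" and x :: "nat \<Rightarrow> real"
    and X :: "real \<Rightarrow> nat \<Rightarrow> real" and p :: "real \<Rightarrow> nat \<Rightarrow> int"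
  assumes scaling: "whittaker_scaling l x X p"
begin

abbreviation int_array :: "real \<Rightarrow> (nat \<times> nat \<Rightarrow> real) \<Rightarrow> nat \<Rightarrow> nat \<Rightarrow> int" where
  "int_array \<epsilon> a \<equiv> with_top l (p \<epsilon>) (lattice_pattern l \<epsilon> a)"

text \<open>Only the rows below the top need rounding: the coordinates \<open>X \<epsilon>\<close>
  already correspond to integer vectors.\<close>

abbreviation real_array :: "real \<Rightarrow> (nat \<times> nat \<Rightarrow> real) \<Rightarrow> nat \<Rightarrow> nat \<Rightarrow> real" where
  "real_array \<epsilon> a \<equiv> with_top l (X \<epsilon>) (rescaled_pattern \<epsilon> a)"

lemma int_array_eq:
  assumes "0 < \<epsilon>" "1 \<le> k" "k \<le> l + 1" "1 \<le> i" "i \<le> k"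
  shows "real_of_int (int_array \<epsilon> a k i) =
           (real k + 1 - 2 * real i) * m_shift \<epsilon> + real_array \<epsilon> a k i / \<epsilon>"
proof (cases "k = l + 1")
  case True
  then show ?thesis using scaling assms by (auto simp: whittaker_scaling_def with_top_def)
next
  case False
  then show ?thesis using assms
    by (simp add: with_top_def lattice_pattern_def rescaled_pattern_def mem_gt_index)
qed

text \<open>The coefficients are written \<open>real 1\<close> and \<open>real 2\<close> so as to
  match the parameter c of the scaling lemmas.\<close>

lemma int_array_diffs:
  assumes "0 < \<epsilon>" "1 \<le> k" "k \<le> l" "1 \<le> i" "i \<le> k"
  shows "real_of_int (int_array \<epsilon> a (k + 1) i - int_array \<epsilon> a k i) =
           real 1 * m_shift \<epsilon> + (real_array \<epsilon> a (k + 1) i - real_array \<epsilon> a k i) / \<epsilon>"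
    and "real_of_int (int_array \<epsilon> a k i - int_array \<epsilon> a (k + 1) (i + 1)) =
           real 1 * m_shift \<epsilon> + (real_array \<epsilon> a k i - real_array \<epsilon> a (k + 1) (i + 1)) / \<epsilon>"
    and "i < k \<Longrightarrow> real_of_int (int_array \<epsilon> a k i - int_array \<epsilon> a k (i + 1)) =
           real 2 * m_shift \<epsilon> + (real_array \<epsilon> a k i - real_array \<epsilon> a k (i + 1)) / \<epsilon>"
  using assms by (simp_all add: int_array_eq algebra_simps diff_divide_distrib del: One_nat_def)

lemma lattice_pattern_mem_iff:
  "lattice_pattern l \<epsilon> a \<in> gz_patterns l (p \<epsilon>) \<longleftrightarrow>
     (\<forall>k\<in>{1..l}. \<forall>i\<in>{1..k}. 0 \<le> int_array \<epsilon> a (k + 1) i - int_array \<epsilon> a k i \<and>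
        0 \<le> int_array \<epsilon> a k i - int_array \<epsilon> a (k + 1) (i + 1))"
  by (auto simp: gz_patterns_def lattice_pattern_def)

lemma tendsto_real_array:
  assumes "1 \<le> k" "k \<le> l + 1" "1 \<le> i" "i \<le> k"
  shows "((\<lambda>\<epsilon>. real_array \<epsilon> a k i) \<longlongrightarrow> with_top l x a k i) (at_right 0)"
  using assms scaling tendsto_rescaled_pattern[of a "(k, i)"]
  by (auto simp: with_top_def whittaker_scaling_def)

text \<open>An exact identity for every eps > 0, since the shifts cancel within each row by
  \<open>sum_pattern_center\<close>.\<close>

lemma spectral_product_eq:
  assumes \<epsilon>: "0 < \<epsilon>"
  shows "(\<Prod>k=1..l+1. exp (\<i> * complex_of_real \<epsilon> * lam k) powi
           ((\<Sum>i=1..k. int_array \<epsilon> a k i) - (\<Sum>i=1..k-1. int_array \<epsilon> a (k - 1) i))) =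
         spectral_factor l lam (real_array \<epsilon> a)"
proof -
  have row: "\<epsilon> * real_of_int (\<Sum>i=1..k. int_array \<epsilon> a k i) = (\<Sum>i=1..k. real_array \<epsilon> a k i)"
    if "k \<le> l + 1" for k
  proof -
    have "real_of_int (\<Sum>i=1..k. int_array \<epsilon> a k i) =
        (\<Sum>i=1..k. (real k + 1 - 2 * real i) * m_shift \<epsilon> + real_array \<epsilon> a k i / \<epsilon>)"
      unfolding of_int_sum using that \<epsilon> by (intro sum.cong refl int_array_eq) auto
    also have "\<dots> = (\<Sum>i=1..k. real k + 1 - 2 * real i) * m_shift \<epsilon> + (\<Sum>i=1..k. real_array \<epsilon> a k i) / \<epsilon>"
      by (simp only: sum.distrib sum_distrib_right sum_divide_distrib)
    finally show ?thesis using \<epsilon> by (simp only: sum_pattern_center) simp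
  qed
  let ?D = "\<lambda>k. (\<Sum>i=1..k. int_array \<epsilon> a k i) - (\<Sum>i=1..k-1. int_array \<epsilon> a (k - 1) i)"
  have "exp (\<i> * complex_of_real \<epsilon> * lam k) powi ?D k =
      exp (\<i> * (lam k * complex_of_real ((\<Sum>i=1..k. real_array \<epsilon> a k i) - (\<Sum>i=1..k-1. real_array \<epsilon> a (k - 1) i))))"
    if "k \<in> {1..l+1}" for k
  proof -
    have "(\<Sum>i=1..k. real_array \<epsilon> a k i) - (\<Sum>i=1..k-1. real_array \<epsilon> a (k - 1) i) = \<epsilon> * real_of_int (?D k)"
    proof -
      have "k \<le> l + 1" "k - 1 \<le> l + 1" using that by auto
      then show ?thesis by (simp only: of_int_diff right_diff_distrib row)
    qed
    moreover have "exp (\<i> * complex_of_real \<epsilon> * lam k) powi ?D k =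
        exp (\<i> * complex_of_real \<epsilon> * lam k * of_int (?D k))"
      by (simp only: exp_power_int mult.commute)
    ultimately show ?thesis by (simp only: of_real_mult of_real_of_int_eq mult_ac)
  qed
  then show ?thesis
    unfolding spectral_factor_def sum_distrib_left by (subst exp_sum) (auto intro!: prod.cong simp del: prod.cl_ivl_Suc)
qed

definition limit_constant :: "real \<Rightarrow> real" where
  "limit_constant \<epsilon> = (exp (A_fun \<epsilon>) / qtail (exp (- \<epsilon>)) 0) ^ (l * (l + 3) div 2)"

definition step_function :: "real \<Rightarrow> (nat \<times> nat \<Rightarrow> real) \<Rightarrow> complex" where
  "step_function \<epsilon> a = (if lattice_pattern l \<epsilon> a \<in> gz_patterns l (p \<epsilon>)
     then complex_of_real (limit_constant \<epsilon>) * (spectral_factor l lam (real_array \<epsilon> a) *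
       complex_of_real (tail_weight (exp (- \<epsilon>)) l (int_array \<epsilon> a))) else 0)"

lemma tendsto_limit_constant: "(limit_constant \<longlongrightarrow> 1) (at_right 0)"
  unfolding limit_constant_def[abs_def]
  using tendsto_power[OF tendsto_exp_A_fun_div_qtail_0] by simp

lemma has_bochner_integral_step_function:
  assumes \<epsilon>: "0 < \<epsilon>" and dom: "\<forall>i\<in>{1..l}. p \<epsilon> i \<ge> p \<epsilon> (i + 1)"
  shows "has_bochner_integral (array_lborel l) (step_function \<epsilon>)
    (complex_of_real (\<epsilon> ^ (l * (l + 1) div 2) * exp (real (l * (l + 3)) / 2 * A_fun \<epsilon>)) *
           q_whittaker (exp (- \<epsilon>)) l (\<lambda>k. exp (\<i> * complex_of_real \<epsilon> * lam k)) (p \<epsilon>))"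
proof -
  define N where "N = l * (l + 3) div 2"
  define K where "K = exp (real (l * (l + 3)) / 2 * A_fun \<epsilon>)"
  \<comment> \<open>Parity identifies the real exponent of the normalisation with the natural power
    of Euler factors.\<close>
  have "even (l * (l + 3))" by simp
  then have "real (l * (l + 3)) / 2 = real N" by (simp add: N_def real_of_nat_div)
  then have K: "K = exp (A_fun \<epsilon>) ^ N" by (simp add: K_def exp_of_nat_mult)
  define g where "g b = complex_of_real K * (let P = with_top l (p \<epsilon>) b in
      (\<Prod>k=1..l+1. exp (\<i> * complex_of_real \<epsilon> * lam k) powi ((\<Sum>i=1..k. P k i) - (\<Sum>i=1..k-1. P (k - 1) i))) *
      complex_of_real (gz_weight (exp (- \<epsilon>)) l P))" for b
  have "step_function \<epsilon> a = (if lattice_pattern l \<epsilon> a \<in> gz_patterns l (p \<epsilon>) then g (lattice_pattern l \<epsilon> a) else 0)" for a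
    unfolding step_function_def g_def Let_def spectral_product_eq[OF \<epsilon>] limit_constant_def
    using \<epsilon> by (simp add: gz_weight_eq K N_def power_divide)
  then have eq: "step_function \<epsilon> = (\<lambda>a. if lattice_pattern l \<epsilon> a \<in> gz_patterns l (p \<epsilon>) then g (lattice_pattern l \<epsilon> a) else 0)"
    by auto
  have "has_bochner_integral (array_lborel l) (step_function \<epsilon>)
      (\<epsilon> ^ card (gt_index l) *\<^sub>R (\<Sum>b\<in>gz_patterns l (p \<epsilon>). g b))"
    unfolding eq array_lborel_def lattice_pattern_def
    by (rule has_bochner_integral_lattice_step) (use \<epsilon> finite_gz_patterns in \<open>auto simp: gz_patterns_def\<close>)
  also have "(\<Sum>b\<in>gz_patterns l (p \<epsilon>). g b) = complex_of_real K *
      q_whittaker (exp (- \<epsilon>)) l (\<lambda>k. exp (\<i> * complex_of_real \<epsilon> * lam k)) (p \<epsilon>)"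
    unfolding q_whittaker_def g_def if_P[OF dom] by (rule sum_distrib_left[symmetric])
  finally show ?thesis by (simp add: card_gt_index K_def scaleR_conv_of_real mult.assoc)
qed

lemma eventually_dominant: "eventually (\<lambda>\<epsilon>. \<forall>i\<in>{1..l}. p \<epsilon> i \<ge> p \<epsilon> (i + 1)) (at_right 0)"
proof (intro eventually_ball_finite ballI)
  fix i assume i: "i \<in> {1..l}"
  have "eventually (\<lambda>\<epsilon>. 0 \<le> p \<epsilon> i - p \<epsilon> (i + 1)) (at_right 0)"
  proof (rule eventually_scaled_nonneg)
    show "real_of_int (p \<epsilon> i - p \<epsilon> (i + 1)) = real 2 * m_shift \<epsilon> + (X \<epsilon> i - X \<epsilon> (i + 1)) / \<epsilon>"
      if "0 < \<epsilon>" for \<epsilon>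
    proof -
      have P: "real_of_int (p \<epsilon> k) = (real l + 2 - 2 * real k) * m_shift \<epsilon> + X \<epsilon> k / \<epsilon>" if "k \<in> {1..l+1}" for k
        using scaling \<open>0 < \<epsilon>\<close> that by (auto simp: whittaker_scaling_def)
      show ?thesis
        unfolding of_int_diff using P[of i] P[of "i + 1"] i by (simp add: algebra_simps diff_divide_distrib)
    qed
    show "((\<lambda>\<epsilon>. X \<epsilon> i - X \<epsilon> (i + 1)) \<longlongrightarrow> x i - x (i + 1)) (at_right 0)"
      using scaling i by (intro tendsto_diff) (auto simp: whittaker_scaling_def)
  qed simp
  then show "eventually (\<lambda>\<epsilon>. p \<epsilon> i \<ge> p \<epsilon> (i + 1)) (at_right 0)"
    by eventually_elim simp
qed simp

lemma tendsto_tail_weight: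
  "((\<lambda>\<epsilon>. tail_weight (exp (- \<epsilon>)) l (int_array \<epsilon> a)) \<longlongrightarrow> exp (- toda_potential l (with_top l x a))) (at_right 0)"
proof -
  let ?Z = "with_top l x a"
  \<comment> \<open>The literal factors 1 and 0 are the values of v for interlacing differences and
    for differences within a row.\<close>
  have "((\<lambda>\<epsilon>. tail_weight (exp (- \<epsilon>)) l (int_array \<epsilon> a)) \<longlongrightarrow> (\<Prod>k=1..l.
     (\<Prod>i=1..k. exp (- (1 * exp (- (?Z (k + 1) i - ?Z k i)))) * exp (- (1 * exp (- (?Z k i - ?Z (k + 1) (i + 1)))))) /
     (\<Prod>i=1..k-1. exp (- (0 * exp (- (?Z k i - ?Z k (i + 1)))))))) (at_right 0)"
    unfolding tail_weight_def
  proof (intro tendsto_prod tendsto_divide tendsto_mult)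
    fix k i assume ki: "k \<in> {1..l}" "i \<in> {1..k}"
    show "((\<lambda>\<epsilon>. qtail (exp (- \<epsilon>)) (nat (int_array \<epsilon> a (k + 1) i - int_array \<epsilon> a k i))) \<longlongrightarrow>
        exp (- (1 * exp (- (?Z (k + 1) i - ?Z k i))))) (at_right 0)"
      by (rule tendsto_qtail_scaled[OF int_array_diffs(1) tendsto_diff[OF tendsto_real_array tendsto_real_array] _
            tendsto_exp_m_shift_1]) (use ki in auto)
    show "((\<lambda>\<epsilon>. qtail (exp (- \<epsilon>)) (nat (int_array \<epsilon> a k i - int_array \<epsilon> a (k + 1) (i + 1)))) \<longlongrightarrow>
        exp (- (1 * exp (- (?Z k i - ?Z (k + 1) (i + 1)))))) (at_right 0)"
      by (rule tendsto_qtail_scaled[OF int_array_diffs(2) tendsto_diff[OF tendsto_real_array tendsto_real_array] _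
            tendsto_exp_m_shift_1]) (use ki in auto)
  next
    fix k i assume ki: "k \<in> {1..l}" "i \<in> {1..k-1}"
    show "((\<lambda>\<epsilon>. qtail (exp (- \<epsilon>)) (nat (int_array \<epsilon> a k i - int_array \<epsilon> a k (i + 1)))) \<longlongrightarrow>
        exp (- (0 * exp (- (?Z k i - ?Z k (i + 1)))))) (at_right 0)"
      by (rule tendsto_qtail_scaled[OF int_array_diffs(3) tendsto_diff[OF tendsto_real_array tendsto_real_array] _
            tendsto_exp_m_shift_2]) (use ki in auto)
  qed auto
  also have "(\<Prod>k=1..l.
     (\<Prod>i=1..k. exp (- (1 * exp (- (?Z (k + 1) i - ?Z k i)))) * exp (- (1 * exp (- (?Z k i - ?Z (k + 1) (i + 1)))))) /
     (\<Prod>i=1..k-1. exp (- (0 * exp (- (?Z k i - ?Z k (i + 1))))))) = exp (- toda_potential l ?Z)"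
    by (simp add: toda_potential_def exp_sum sum_negf[symmetric] exp_add[symmetric])
  finally show ?thesis .
qed

text \<open>For a fixed array all interlacing conditions hold once eps is small, because every
  interlacing difference contains m. So the constraint disappears and the limit integral runs over
  the whole space.\<close>

lemma tendsto_step_function:
  "((\<lambda>\<epsilon>. step_function \<epsilon> a) \<longlongrightarrow> givental_integrand l lam x a) (at_right 0)"
proof (rule Lim_transform_eventually)
  have "((\<lambda>\<epsilon>. spectral_factor l lam (real_array \<epsilon> a)) \<longlongrightarrow> spectral_factor l lam (with_top l x a)) (at_right 0)"
    unfolding spectral_factor_def by (intro tendsto_intros tendsto_real_array) auto
  then have "((\<lambda>\<epsilon>. complex_of_real (limit_constant \<epsilon>) * (spectral_factor l lam (real_array \<epsilon> a) *
       complex_of_real (tail_weight (exp (- \<epsilon>)) l (int_array \<epsilon> a)))) \<longlongrightarrow> complex_of_real 1 *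
       (spectral_factor l lam (with_top l x a) * complex_of_real (exp (- toda_potential l (with_top l x a))))) (at_right 0)"
    by (intro tendsto_mult tendsto_of_real tendsto_limit_constant tendsto_tail_weight)
  then show "((\<lambda>\<epsilon>. complex_of_real (limit_constant \<epsilon>) * (spectral_factor l lam (real_array \<epsilon> a) *
       complex_of_real (tail_weight (exp (- \<epsilon>)) l (int_array \<epsilon> a)))) \<longlongrightarrow> givental_integrand l lam x a) (at_right 0)"
    by (simp add: givental_integrand_eq)
  have "eventually (\<lambda>\<epsilon>. lattice_pattern l \<epsilon> a \<in> gz_patterns l (p \<epsilon>)) (at_right 0)"
    unfolding lattice_pattern_mem_iff
  proof (intro eventually_ball_finite ballI eventually_conj)
    fix k i assume ki: "k \<in> {1..l}" "i \<in> {1..k}"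
    show "eventually (\<lambda>\<epsilon>. 0 \<le> int_array \<epsilon> a (k + 1) i - int_array \<epsilon> a k i) (at_right 0)"
      by (rule eventually_scaled_nonneg[OF int_array_diffs(1) tendsto_diff[OF tendsto_real_array tendsto_real_array]])
        (use ki in auto)
    show "eventually (\<lambda>\<epsilon>. 0 \<le> int_array \<epsilon> a k i - int_array \<epsilon> a (k + 1) (i + 1)) (at_right 0)"
      by (rule eventually_scaled_nonneg[OF int_array_diffs(2) tendsto_diff[OF tendsto_real_array tendsto_real_array]])
        (use ki in auto)
  qed auto
  then show "eventually (\<lambda>\<epsilon>. complex_of_real (limit_constant \<epsilon>) * (spectral_factor l lam (real_array \<epsilon> a) *
       complex_of_real (tail_weight (exp (- \<epsilon>)) l (int_array \<epsilon> a))) = step_function \<epsilon> a) (at_right 0)"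
    by eventually_elim (simp add: step_function_def)
qed

lemma eventually_step_function_bounded:
  obtains w where "integrable (array_lborel l) w"
    "eventually (\<lambda>\<epsilon>. \<forall>a. norm (step_function \<epsilon> a) \<le> w a) (at_right 0)"
proof -
  define B where "B = 2 * (\<Sum>n=1..l+1. norm (lam n))"
  define c where "c = exp (- 4) / (2::real)"
  \<comment> \<open>The number of entries including the top row. Each moves by at most 1 under
    rounding and under the change from x to \<open>X \<epsilon>\<close>, which costs the factor
    \<open>exp (B * n)\<close>.\<close>
  define n where "n = (\<Sum>k=1..l+1. real k)"
  have B: "0 \<le> B" by (simp add: B_def sum_nonneg del: sum.cl_ivl_Suc)
  have c: "0 < c" by (simp add: c_def)
  obtain C where C: "\<And>a. exp (B * pattern_norm l (with_top l x a)) * exp (- c * toda_potential l (with_top l x a))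
      \<le> C * array_envelope l a"
    using exp_pattern_norm_le_array_envelope[OF B c] by blast
  \<comment> \<open>The 2 bounds \<open>limit_constant\<close>, which is eventually within 1 of its
    limit 1.\<close>
  define w where "w a = 2 * exp (B * n) * (C * array_envelope l a)" for a
  have "integrable (array_lborel l) w"
    unfolding w_def[abs_def] by (intro integrable_mult_right integrable_array_envelope)
  moreover have "eventually (\<lambda>\<epsilon>. \<forall>a. norm (step_function \<epsilon> a) \<le> w a) (at_right 0)"
  proof -
    have "eventually (\<lambda>\<epsilon>. \<forall>k\<in>{1..l+1}. dist (X \<epsilon> k) (x k) < 1) (at_right 0)"
      using scaling by (intro eventually_ball_finite ballI tendstoD) (auto simp: whittaker_scaling_def)
    moreover have "eventually (\<lambda>\<epsilon>. dist (limit_constant \<epsilon>) 1 < 1) (at_right 0)"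
      using tendsto_limit_constant by (rule tendstoD) simp
    moreover have "eventually (\<lambda>\<epsilon>::real. \<epsilon> \<le> 1) (at_right 0)" by real_asymp
    ultimately show ?thesis using eventually_at_right_less[of "0::real"]
    proof eventually_elim
      case (elim \<epsilon>)
      have q: "0 < exp (- \<epsilon>)" "exp (- \<epsilon>) < 1" using elim by auto
      show ?case
      proof
        fix a
        let ?Z = "with_top l x a" and ?Y = "real_array \<epsilon> a" and ?P = "int_array \<epsilon> a"
        have close: "\<bar>?Y k i - ?Z k i\<bar> \<le> 1" if "1 \<le> k" "k \<le> l + 1" "1 \<le> i" "i \<le> k" for k i
        proof (cases "k = l + 1")
          case True
          then have "dist (X \<epsilon> i) (x i) < 1" using elim(1) that by auto
          with True show ?thesis by (simp add: with_top_def dist_real_def)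
        next
          case False
          then show ?thesis
            using rescaled_pattern_diff_le[OF elim(4), of a "(k, i)"] elim(3) by (simp add: with_top_def)
        qed
        show "norm (step_function \<epsilon> a) \<le> w a"
        proof (cases "lattice_pattern l \<epsilon> a \<in> gz_patterns l (p \<epsilon>)")
          case False
          have "0 \<le> C * array_envelope l a" by (rule order_trans[OF _ C[of a]]) simp
          with False show ?thesis by (simp add: step_function_def w_def)
        next
          case True
          then have nonneg: "0 \<le> ?P (k + 1) i - ?P k i" "0 \<le> ?P k i - ?P (k + 1) (i + 1)"
            if "1 \<le> k" "k \<le> l" "1 \<le> i" "i \<le> k" for k i
            using that unfolding lattice_pattern_mem_iff by auto
          have "pattern_norm l ?Y \<le> (\<Sum>k=1..l+1. \<Sum>i=1..k. \<bar>?Z k i\<bar> + 1)"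
            unfolding pattern_norm_def
          proof (intro sum_mono)
            fix k i assume "k \<in> {1..l+1}" "i \<in> {1..k}"
            then show "\<bar>?Y k i\<bar> \<le> \<bar>?Z k i\<bar> + 1" using close[of k i] by auto
          qed
          also have "\<dots> = pattern_norm l ?Z + n"
            by (simp add: pattern_norm_def n_def sum.distrib)
          finally have "B * pattern_norm l ?Y \<le> B * (pattern_norm l ?Z + n)"
            using B by (rule mult_left_mono)
          also have "\<dots> = B * n + B * pattern_norm l ?Z"
            by (simp only: distrib_left add.commute)
          finally have "exp (B * pattern_norm l ?Y) \<le> exp (B * n) * exp (B * pattern_norm l ?Z)"
            by (simp only: exp_add[symmetric] exp_le_cancel_iff)
          with norm_spectral_factor_le[of l lam ?Y]
          have "norm (spectral_factor l lam ?Y) \<le> exp (B * n) * exp (B * pattern_norm l ?Z)"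
            unfolding B_def by (rule order_trans)
          moreover have "tail_weight (exp (- \<epsilon>)) l ?P \<le> exp (- c * toda_potential l ?Z)"
          proof -
            have "tail_weight (exp (- \<epsilon>)) l ?P \<le> (\<Prod>k=1..l. \<Prod>i=1..k.
                sqrt (qtail (exp (- \<epsilon>)) (nat (?P (k + 1) i - ?P k i))) *
                sqrt (qtail (exp (- \<epsilon>)) (nat (?P k i - ?P (k + 1) (i + 1)))))"
              by (rule tail_weight_le[OF q]) (use nonneg in fastforce)
            also have "\<dots> \<le> (\<Prod>k=1..l. \<Prod>i=1..k.
                exp (- c * exp (- (?Z (k + 1) i - ?Z k i))) * exp (- c * exp (- (?Z k i - ?Z (k + 1) (i + 1)))))"
            proof (intro prod_mono conjI mult_mono prod_nonneg mult_nonneg_nonneg ballI)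
              fix k i assume ki: "k \<in> {1..l}" "i \<in> {1..k}"
              show "sqrt (qtail (exp (- \<epsilon>)) (nat (?P (k + 1) i - ?P k i))) \<le> exp (- c * exp (- (?Z (k + 1) i - ?Z k i)))"
                unfolding c_def
                by (rule sqrt_qtail_scaled_le[OF elim(4,3) nonneg(1) int_array_diffs(1)[simplified of_nat_1 mult_1]])
                  (use ki elim close[of k i] close[of "k + 1" i] in auto)
              show "sqrt (qtail (exp (- \<epsilon>)) (nat (?P k i - ?P (k + 1) (i + 1)))) \<le> exp (- c * exp (- (?Z k i - ?Z (k + 1) (i + 1))))"
                unfolding c_def
                by (rule sqrt_qtail_scaled_le[OF elim(4,3) nonneg(2) int_array_diffs(2)[simplified of_nat_1 mult_1]])
                  (use ki elim close[of k i] close[of "k + 1" "i + 1"] in auto)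
            qed (auto intro: less_imp_le qtail_pos q)
            also have "\<dots> = exp (- c * toda_potential l ?Z)"
              by (simp add: toda_potential_def exp_sum sum_negf[symmetric] exp_add[symmetric] sum_distrib_left
                  distrib_left)
            finally show ?thesis .
          qed
          moreover have "\<bar>limit_constant \<epsilon>\<bar> \<le> 2" using elim(2) by (simp add: dist_real_def)
          moreover have "norm (step_function \<epsilon> a) =
              \<bar>limit_constant \<epsilon>\<bar> * (norm (spectral_factor l lam ?Y) * tail_weight (exp (- \<epsilon>)) l ?P)"
            using True tail_weight_nonneg[OF q] by (simp add: step_function_def norm_mult)
          ultimately have "norm (step_function \<epsilon> a) \<le>
              2 * ((exp (B * n) * exp (B * pattern_norm l ?Z)) * exp (- c * toda_potential l ?Z))"
            using tail_weight_nonneg[OF q]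
            by (simp only:) (intro mult_mono; simp)
          also have "\<dots> = 2 * exp (B * n) * (exp (B * pattern_norm l ?Z) * exp (- c * toda_potential l ?Z))"
            by simp
          also have "\<dots> \<le> w a"
            unfolding w_def by (intro mult_left_mono C) simp
          finally show ?thesis .
        qed
      qed
    qed
  qed
  ultimately show ?thesis by (rule that)
qed

lemma tendsto_integral_step_function:
  "((\<lambda>\<epsilon>. integral\<^sup>L (array_lborel l) (step_function \<epsilon>)) \<longlongrightarrow> whittaker l lam x) (at_right 0)"
proof -
  obtain w where w: "integrable (array_lborel l) w"
    "eventually (\<lambda>\<epsilon>. \<forall>a. norm (step_function \<epsilon> a) \<le> w a) (at_right 0)"
    using eventually_step_function_bounded by blast
  show ?thesis
    \<comment> \<open>Dominated convergence is applied along arbitrary sequences of positive eps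
      tending to 0.\<close>
    unfolding whittaker_def tendsto_at_iff_sequentially comp_def
  proof (intro allI impI)
    fix e :: "nat \<Rightarrow> real" assume e: "\<forall>i. e i \<in> {0<..} - {0}" "e \<longlonglongrightarrow> 0"
    then have pos: "0 < e i" for i by auto
    have lim: "filterlim e (at_right 0) sequentially"
      using e(2) by (simp add: filterlim_at pos less_imp_neq[OF pos, symmetric])
    have "eventually (\<lambda>n. (\<forall>a. norm (step_function (e n) a) \<le> w a) \<and> (\<forall>i\<in>{1..l}. p (e n) i \<ge> p (e n) (i + 1))) sequentially"
      using eventually_conj[OF w(2) eventually_dominant] lim by (auto simp: filterlim_iff)
    then obtain N where N: "\<And>n a. N \<le> n \<Longrightarrow> norm (step_function (e n) a) \<le> w a"
      "\<And>n. N \<le> n \<Longrightarrow> \<forall>i\<in>{1..l}. p (e n) i \<ge> p (e n) (i + 1)"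
      unfolding eventually_sequentially by blast
    show "(\<lambda>n. integral\<^sup>L (array_lborel l) (step_function (e n))) \<longlonglongrightarrow> integral\<^sup>L (array_lborel l) (givental_integrand l lam x)"
    \<comment> \<open>The first N terms are dropped: the majorant and the dominance of the top row,
      from which measurability is obtained, are only known eventually.\<close>
    proof (rule LIMSEQ_offset, rule integral_dominated_convergence[OF measurable_givental_integrand _ w(1)])
      show "step_function (e (n + N)) \<in> borel_measurable (array_lborel l)" for n
        using has_bochner_integral_step_function[of "e (n + N)"] N(2)[of "n + N"] e(1)
        by (auto simp: has_bochner_integral_iff intro: borel_measurable_integrable)
      show "AE a in array_lborel l. norm (step_function (e (n + N)) a) \<le> w a" for n
        using N(1) by simp
      show "AE a in array_lborel l. (\<lambda>n. step_function (e (n + N)) a) \<longlonglongrightarrow> givental_integrand l lam x a"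
        using filterlim_compose[OF tendsto_step_function lim] by (intro AE_I2 LIMSEQ_ignore_initial_segment)
    qed
  qed
qed

lemma tendsto_scaled_q_whittaker:
  "((\<lambda>\<epsilon>. complex_of_real (\<epsilon> ^ (l * (l + 1) div 2) * exp (real (l * (l + 3)) / 2 * A_fun \<epsilon>)) *
           q_whittaker (exp (- \<epsilon>)) l (\<lambda>k. exp (\<i> * complex_of_real \<epsilon> * lam k)) (p \<epsilon>))
      \<longlongrightarrow> whittaker l lam x) (at_right 0)"
proof (rule Lim_transform_eventually[OF tendsto_integral_step_function])
  show "eventually (\<lambda>\<epsilon>. integral\<^sup>L (array_lborel l) (step_function \<epsilon>) =
      complex_of_real (\<epsilon> ^ (l * (l + 1) div 2) * exp (real (l * (l + 3)) / 2 * A_fun \<epsilon>)) *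
           q_whittaker (exp (- \<epsilon>)) l (\<lambda>k. exp (\<i> * complex_of_real \<epsilon> * lam k)) (p \<epsilon>)) (at_right 0)"
    using eventually_dominant eventually_at_right_less[of "0::real"]
    by eventually_elim (rule has_bochner_integral_integral_eq, rule has_bochner_integral_step_function)
qed

end

text \<open>Integrability is part of the claim because a Bochner integral defaults to 0 otherwise,
  and the limit would then say nothing about the Givental integral.\<close>

theorem theorem3p1:
  fixes l :: nat and lam :: "nat \<Rightarrow> complex" and x :: "nat \<Rightarrow> real"
    and X :: "real \<Rightarrow> nat \<Rightarrow> real" and p :: "real \<Rightarrow> nat \<Rightarrow> int"
  assumes "whittaker_scaling l x X p"
  shows "integrable (array_lborel l) (givental_integrand l lam x) \<and>
    ((\<lambda>\<epsilon>. complex_of_real (\<epsilon> ^ (l * (l + 1) div 2) * exp (real (l * (l + 3)) / 2 * A_fun \<epsilon>)) *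
           q_whittaker (exp (- \<epsilon>)) l (\<lambda>k. exp (\<i> * complex_of_real \<epsilon> * lam k)) (p \<epsilon>))
      \<longlongrightarrow> whittaker l lam x) (at_right 0)"
  using integrable_givental_integrand tendsto_scaled_q_whittaker[OF assms] by blast

end
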